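(* Let $\alpha:\mathcal{J}\times\mathcal{J}\to\mathbb{R}$ be a function satisfying $\alpha(d_1,d_2)=\alpha(Md_1,Md_2)$ (for all $d_1,d_2\in\mathcal{J}$) for any orthogonal automorphism $M:\mathcal{J}\to\mathcal{J}$ of $\mathcal{K}$. Then, for any automorphism $T:\mathcal{J}\to\mathcal{J}$ of $\mathcal{K}$, any $w\in\mathrm{int}\,\mathcal{K}$, and any $\mu>0$, \[ Q(\tilde w^{1/2})\exp\big(\alpha(\tilde d_1,\tilde d_2)\,\tilde d\big)=T\,Q(w^{1/2})\exp\big(\alpha(d_1,d_2)\,d\big), \] where $\tilde w=Tw$, $d=d_N(w,\mu)$, $\tilde d=d_{N,T}(\tilde w,\mu)$, $d_i=d_i(w,\mu)$, and $\tilde d_i=d_{i,T}(\tilde w,\mu)$ for $i\in\{1,2\}$.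
   Context: Setting. $\mathcal{J}$ is a (finite-dimensional real) Euclidean Jordan algebra of rank $n$ with product $\circ$, identity $e$, trace $\mathrm{tr}$, inner product $\langle u,v\rangle=\mathrm{tr}(u\circ v)$. $\mathcal{K}=\{u\circ u:u\in\mathcal{J}\}$ is its cone of squares, with interior $\mathrm{int}\,\mathcal{K}$. Functions such as $\exp$, $u^{1/2}$, $u^{-1}$ are applied spectrally. $Q(u)v:=2u\circ(u\circ v)-(u\circ u)\circ v$. An automorphism of $\mathcal{K}$ is an invertible linear map $T:\mathcal{J}\to\mathcal{J}$ with $T(\mathcal{K})=\mathcal{K}$; it is orthogonal if $T^{-1}=T^*$, where $T^*$ is the adjoint. $\mathcal{L}\subseteq\mathcal{J}$ is a linear subspace with orthogonal complement $\mathcal{L}^\perp$, and $x_0,s_0\in\mathcal{J}$. Standing assumption (Slater): $\mathrm{int}\,\mathcal{K}\cap(x_0+\mathcal{L})\neq\emptyset$ and $\mathrm{int}\,\mathcal{K}\cap(s_0+\mathcal{L}^\perp)\ne\emptyset$. Newton direction. For $w\in\mathrm{int}\,\mathcal{K}$ and $\mu>0$, $d_N(w,\mu)$ is the unique $d\in\mathcal{J}$ with $Q(w^{1/2})(e+d)\in\frac1{\sqrt\mu}x_0+\mathcal{L}$ and $Q(w^{-1/2})(e-d)\in\frac1{\sqrt\mu}s_0+\mathcal{L}^\perp$. With $\mathcal{L}_w:=Q(w^{-1/2})\mathcal{L}$ (so $\mathcal{L}_w^\perp=Q(w^{1/2})\mathcal{L}^\perp$), its direct summands are \[ d_1(w,\mu)=\mathrm{proj}_{\mathcal{L}_w^\perp}\big(Q(w^{-1/2})(\tfrac1{\sqrt\mu}x_0-w)\big),\quad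 d_2(w,\mu)=\mathrm{proj}_{\mathcal{L}_w}\big(Q(w^{1/2})(\tfrac1{\sqrt\mu}s_0-w^{-1})\big), \] and $d_N=d_1-d_2$ (orthogonal projections). Transformed problem. For an automorphism $T$ of $\mathcal{K}$, the transformed data are $Tx_0$, $(T^{-1})^*s_0$, $T\mathcal{L}$ and $(T^{-1})^*\mathcal{L}^\perp=(T\mathcal{L})^\perp$ in place of $x_0,s_0,\mathcal{L},\mathcal{L}^\perp$. For $v\in\mathrm{int}\,\mathcal{K}$ and $\mu>0$, $d_{N,T}(v,\mu)$ is the unique $d\in\mathcal{J}$ with $Q(v^{1/2})(e+d)\in\frac1{\sqrt\mu}Tx_0+T\mathcal{L}$ and $Q(v^{-1/2})(e-d)\in\frac1{\sqrt\mu}(T^{-1})^*s_0+(T^{-1})^*\mathcal{L}^\perp$. With $\mathcal{L}_{T,v}:=Q(v^{-1/2})T\mathcal{L}$ (so $\mathcal{L}_{T,v}^\perp=Q(v^{1/2})(T^{-1})^*\mathcal{L}^\perp$), its direct summands are \[ d_{1,T}(v,\mu)=\mathrm{proj}_{\mathcal{L}_{T,v}^\perp}\big(Q(v^{-1/2})(\tfrac1{\sqrt\mu}Tx_0-v)\big),\quad d_{2,T}(v,\mu)=\mathrm{proj}_{\mathcal{L}_{T,v}}\big(Q(v^{1/2})(\tfrac1{\sqrt\mu}(T^{-1})^*s_0-v^{-1})\big), \] and $d_{N,T}=d_{1,T}-d_{2,T}$. *)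

theory Defs
  imports "HOL-Analysis.Analysis"
begin

class euclidean_jordan_algebra = euclidean_space +
  fixes jprod :: "'a \<Rightarrow> 'a \<Rightarrow> 'a"  (infixl \<open>\<odot>\<close> 70)
    and junit :: 'a  (\<open>\<e>\<close>)
  assumes jprod_add_left: "(x + y) \<odot> z = x \<odot> z + y \<odot> z"
    and jprod_scaleR_left: "(scaleR a x) \<odot> y = scaleR a (x \<odot> y)"
    and jprod_commute: "x \<odot> y = y \<odot> x"
    and jordan_identity: "(x \<odot> y) \<odot> (x \<odot> x) = x \<odot> (y \<odot> (x \<odot> x))"
    and junit_left: "\<e> \<odot> x = x"
    and inner_jprod: "inner (x \<odot> y) z = inner y (x \<odot> z)"

primrec jpow :: "'a::euclidean_jordan_algebra \<Rightarrow> nat \<Rightarrow> 'a" where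
  "jpow u 0 = \<e>"
| "jpow u (Suc k) = u \<odot> jpow u k"

text \<open>The degree of the minimal polynomial of \<open>u\<close>.\<close>

definition jdegree :: "'a::euclidean_jordan_algebra \<Rightarrow> nat" where
  "jdegree u = (LEAST m. jpow u m \<in> span (jpow u ` {..<m}))"

definition jordan_rank :: "'a::euclidean_jordan_algebra itself \<Rightarrow> nat" where
  "jordan_rank _ = Max (range (jdegree :: 'a \<Rightarrow> nat))"

definition idempotent :: "'a::euclidean_jordan_algebra \<Rightarrow> bool" where
  "idempotent c \<longleftrightarrow> c \<odot> c = c"

definition primitive_idempotent :: "'a::euclidean_jordan_algebra \<Rightarrow> bool" where
  "primitive_idempotent c \<longleftrightarrow> idempotent c \<and> c \<noteq> 0 \<and>
     \<not> (\<exists>a b. idempotent a \<and> idempotent b \<and> a \<noteq> 0 \<and> b \<noteq> 0 \<and> c = a + b)"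

text \<open>A Jordan frame can be given as a set, because pairwise orthogonal nonzero
  idempotents are distinct.\<close>

definition jordan_frame :: "'a::euclidean_jordan_algebra set \<Rightarrow> bool" where
  "jordan_frame C \<longleftrightarrow> finite C \<and> (\<forall>c\<in>C. primitive_idempotent c) \<and>
     (\<forall>c\<in>C. \<forall>c'\<in>C. c \<noteq> c' \<longrightarrow> c \<odot> c' = 0) \<and> (\<Sum>c\<in>C. c) = \<e>"

text \<open>\<open>l c\<close> is the eigenvalue attached to \<open>c \<in> C\<close>. Eigenvalues attached to different
  elements of \<open>C\<close> may coincide, so that they occur with their multiplicity.\<close>

definition spectral_decomposition ::
    "'a::euclidean_jordan_algebra \<Rightarrow> 'a set \<Rightarrow> ('a \<Rightarrow> real) \<Rightarrow> bool" where
  "spectral_decomposition u C l \<longleftrightarrow> jordan_frame C \<and> u = (\<Sum>c\<in>C. l c *\<^sub>R c)"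

definition spectral_map :: "(real \<Rightarrow> real) \<Rightarrow> 'a::euclidean_jordan_algebra \<Rightarrow> 'a" where
  "spectral_map f u =
     (THE v. \<exists>C l. spectral_decomposition u C l \<and> v = (\<Sum>c\<in>C. f (l c) *\<^sub>R c))"

definition jtrace :: "'a::euclidean_jordan_algebra \<Rightarrow> real" where
  "jtrace u = (THE t. \<exists>C l. spectral_decomposition u C l \<and> t = (\<Sum>c\<in>C. l c))"

definition jexp :: "'a::euclidean_jordan_algebra \<Rightarrow> 'a" where
  "jexp = spectral_map exp"

definition jsqrt :: "'a::euclidean_jordan_algebra \<Rightarrow> 'a" where
  "jsqrt = spectral_map sqrt"

definition jinv :: "'a::euclidean_jordan_algebra \<Rightarrow> 'a" where
  "jinv = spectral_map inverse"

definition jinvsqrt :: "'a::euclidean_jordan_algebra \<Rightarrow> 'a" where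
  "jinvsqrt = spectral_map (\<lambda>t. 1 / sqrt t)"

definition Q :: "'a::euclidean_jordan_algebra \<Rightarrow> 'a \<Rightarrow> 'a" where
  "Q u v = 2 *\<^sub>R (u \<odot> (u \<odot> v)) - (u \<odot> u) \<odot> v"

definition cone_of_squares :: "'a::euclidean_jordan_algebra set"  (\<open>\<K>\<close>) where
  "\<K> = {u \<odot> u | u. True}"

definition cone_automorphism :: "('a::euclidean_jordan_algebra \<Rightarrow> 'a) \<Rightarrow> bool" where
  "cone_automorphism T \<longleftrightarrow> linear T \<and> bij T \<and> T ` \<K> = \<K>"

definition orthogonal_cone_automorphism ::
    "('a::euclidean_jordan_algebra \<Rightarrow> 'a) \<Rightarrow> bool" where
  "orthogonal_cone_automorphism M \<longleftrightarrow> cone_automorphism M \<and> inv M = adjoint M"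

definition proj :: "'a::euclidean_space set \<Rightarrow> 'a \<Rightarrow> 'a" where
  "proj L x = (THE y. y \<in> L \<and> x - y \<in> orthogonal_comp L)"

text \<open>The argument \<open>L'\<close> is the direction space of the dual affine constraint: \<open>L\<^sup>\<bottom>\<close> for the
  original problem, and the image of \<open>L\<^sup>\<bottom>\<close> under the adjoint of the inverse of \<open>T\<close> for
  the transformed one.\<close>

definition newton_direction ::
    "'a::euclidean_jordan_algebra \<Rightarrow> 'a \<Rightarrow> 'a set \<Rightarrow> 'a set \<Rightarrow> 'a \<Rightarrow> real \<Rightarrow> 'a" where
  "newton_direction x0 s0 L L' w \<mu> =
     (THE d. Q (jsqrt w) (\<e> + d) \<in> {(1 / sqrt \<mu>) *\<^sub>R x0 + l | l. l \<in> L} \<and>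
             Q (jinvsqrt w) (\<e> - d) \<in> {(1 / sqrt \<mu>) *\<^sub>R s0 + l | l. l \<in> L'})"

definition newton_summand1 ::
    "'a::euclidean_jordan_algebra \<Rightarrow> 'a set \<Rightarrow> 'a \<Rightarrow> real \<Rightarrow> 'a" where
  "newton_summand1 x0 L w \<mu> =
     proj (orthogonal_comp (Q (jinvsqrt w) ` L)) (Q (jinvsqrt w) ((1 / sqrt \<mu>) *\<^sub>R x0 - w))"

definition newton_summand2 ::
    "'a::euclidean_jordan_algebra \<Rightarrow> 'a set \<Rightarrow> 'a \<Rightarrow> real \<Rightarrow> 'a" where
  "newton_summand2 s0 L w \<mu> =
     proj (Q (jinvsqrt w) ` L) (Q (jsqrt w) ((1 / sqrt \<mu>) *\<^sub>R s0 - jinv w))"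

end

theory Submission
  imports Defs
begin

text \<open>Let \<open>M = Q (jinvsqrt (T w)) \<circ> T \<circ> Q (jsqrt w)\<close>. This is an automorphism of the cone that fixes
  \<open>\<e>\<close>. It therefore permutes the extreme points of the order interval \<open>[0, \<e>]\<close>, which are the
  idempotents, hence maps Jordan frames to Jordan frames, commutes with the functional calculus,
  respects the product and the trace, and is orthogonal for the trace inner product. The Newton
  direction is the difference of its two summands, which are orthogonal projections, so \<open>M\<close> maps
  all three to their transformed counterparts, and \<open>\<alpha>\<close> does not change. The claim is then
  \<open>Q (jsqrt (T w)) \<circ> M = T \<circ> Q (jsqrt w)\<close> together with \<open>jexp (M u) = M (jexp u)\<close>.\<close>

section \<open>Power associativity and self-adjoint operators\<close>

text \<open>At first \<open>M\<close> is known to respect only the linear structure, the order and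
  the unit; product, trace and spectral functions must be recovered from these. Hence idempotents
  are described by the order alone, and orthogonality of two of them is read off from idempotence of
  their sum. The obstacle is that \<open>M\<close> preserves the cone at all: its outer factors are
  quadratic representations, and their positivity rests on the spectral theorem, on self-duality of
  \<open>\<K>\<close> and on the Peirce decomposition, all derived from the class axioms. The link
  between inner product and trace enters only late, to turn preservation of product and trace into
  orthogonality of \<open>M\<close>.\<close>

lemma jprod_scaleR_right: "x \<odot> (a *\<^sub>R y) = a *\<^sub>R (x \<odot> y)"
  by (metis jprod_commute jprod_scaleR_left)

lemma jprod_add_right: "x \<odot> (y + z) = x \<odot> y + x \<odot> z"
  by (metis jprod_commute jprod_add_left)

lemma bounded_bilinear_jprod: "bounded_bilinear ((\<odot>) :: 'a::euclidean_jordan_algebra \<Rightarrow> 'a \<Rightarrow> 'a)"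
  by (simp add: bilinear_conv_bounded_bilinear [symmetric] bilinear_def linear_iff
      jprod_add_left jprod_add_right jprod_scaleR_left jprod_scaleR_right)

interpretation jprod: bounded_bilinear "(\<odot>) :: 'a::euclidean_jordan_algebra \<Rightarrow> 'a \<Rightarrow> 'a"
  by (rule bounded_bilinear_jprod)

lemmas jprod_linear_simps =
  jprod.add_left jprod.add_right jprod.diff_left jprod.diff_right jprod.minus_left jprod.minus_right
  jprod.scaleR_left jprod.scaleR_right

lemma junit_right: "x \<odot> \<e> = x"
  by (metis jprod_commute junit_left)

lemma inner_jprod_left: "inner (x \<odot> y) z = inner x (y \<odot> z)"
  by (metis inner_jprod jprod_commute)

lemma jordan_linearized:
  fixes a b c d :: "'a::euclidean_jordan_algebra"
  shows "(b \<odot> c) \<odot> (a \<odot> d) + (a \<odot> c) \<odot> (b \<odot> d) + (a \<odot> b) \<odot> (c \<odot> d) =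
         a \<odot> ((b \<odot> c) \<odot> d) + b \<odot> ((a \<odot> c) \<odot> d) + c \<odot> ((a \<odot> b) \<odot> d)"
proof -
  define F where "F x = (x \<odot> x) \<odot> (x \<odot> d) - x \<odot> ((x \<odot> x) \<odot> d)" for x
  have F0: "F x = 0" for x
    using jordan_identity[of x d] by (simp add: F_def jprod_commute)
  \<comment> \<open>\<open>F\<close> is cubic in \<open>x\<close>, so this inclusion-exclusion sum
    keeps exactly the terms that contain each of \<open>a\<close>, \<open>b\<close>,
    \<open>c\<close> once; by commutativity each of them occurs twice.\<close>
  have "2 *\<^sub>R (((b \<odot> c) \<odot> (a \<odot> d) + (a \<odot> c) \<odot> (b \<odot> d) + (a \<odot> b) \<odot> (c \<odot> d)) -
         (a \<odot> ((b \<odot> c) \<odot> d) + b \<odot> ((a \<odot> c) \<odot> d) + c \<odot> ((a \<odot> b) \<odot> d)))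
     = F (a + b + c) - F (a + b) - F (a + c) - F (b + c) + F a + F b + F c"
    unfolding F_def jprod_linear_simps
    by (simp add: jprod_commute[of b a] jprod_commute[of c a] jprod_commute[of c b]
        scaleR_2 algebra_simps)
  then show ?thesis
    by (simp add: F0)
qed

text \<open>The left side of \<open>jordan_linearized\<close> is symmetric under exchanging
  \<open>a\<close> and \<open>d\<close>, hence so is the right side. With \<open>d = v\<close> this
  expresses multiplication by a triple product through multiplications by single factors and by
  pairs.\<close>

lemma jprod_assoc_expand:
  fixes a b c v :: "'a::euclidean_jordan_algebra"
  shows "(a \<odot> (b \<odot> c)) \<odot> v = a \<odot> ((b \<odot> c) \<odot> v) + b \<odot> ((a \<odot> c) \<odot> v) + c \<odot> ((a \<odot> b) \<odot> v)
           - b \<odot> (a \<odot> (c \<odot> v)) - c \<odot> (a \<odot> (b \<odot> v))"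
proof -
  have "a \<odot> ((b \<odot> c) \<odot> v) + b \<odot> ((a \<odot> c) \<odot> v) + c \<odot> ((a \<odot> b) \<odot> v) =
        v \<odot> ((b \<odot> c) \<odot> a) + b \<odot> ((v \<odot> c) \<odot> a) + c \<odot> ((v \<odot> b) \<odot> a)"
    unfolding jordan_linearized[symmetric]
    by (simp add: jprod_commute add.commute add.left_commute)
  then show ?thesis
    by (simp add: jprod_commute algebra_simps)
qed

text \<open>Expanding multiplication by \<open>x \<odot> (x \<odot> jpow x m)\<close> leaves only
  multiplications by \<open>x\<close>, its square and two lower powers. The square commutes with
  \<open>x\<close> by the Jordan identity, the lower powers by strong induction.\<close>

lemma jpow_commutes:
  fixes x v :: "'a::euclidean_jordan_algebra"
  shows "jpow x n \<odot> (x \<odot> v) = x \<odot> (jpow x n \<odot> v)"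
proof (induction n arbitrary: v rule: less_induct)
  case (less n)
  consider "n = 0" | "n = 1" | m where "n = Suc (Suc m)"
    by (metis One_nat_def not0_implies_Suc)
  then show ?case
  proof cases
    case 3
    have comm: "jpow x m \<odot> (x \<odot> u) = x \<odot> (jpow x m \<odot> u)"
      "(x \<odot> jpow x m) \<odot> (x \<odot> u) = x \<odot> ((x \<odot> jpow x m) \<odot> u)" for u
      using less[of m u] less[of "Suc m" u] 3 by simp_all
    have square: "(x \<odot> x) \<odot> (x \<odot> u) = x \<odot> ((x \<odot> x) \<odot> u)" for u
      using jordan_identity[of x u] by (simp add: jprod_commute)
    show ?thesis
      unfolding 3 jpow.simps jprod_assoc_expand[of x x "jpow x m"]
      by (simp add: jprod_linear_simps comm square)
  qed (simp_all add: junit_left junit_right)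
qed

lemma jpow_add: "jpow x m \<odot> jpow x n = jpow x (m + n)"
proof (induction m)
  case (Suc m)
  have "jpow x (Suc m) \<odot> jpow x n = jpow x n \<odot> (x \<odot> jpow x m)"
    by (simp add: jprod_commute)
  also have "\<dots> = x \<odot> (jpow x m \<odot> jpow x n)"
    by (metis jpow_commutes jprod_commute)
  finally show ?case
    using Suc by simp
qed (simp add: junit_left)

text \<open>Power associativity makes the span of the powers an associative algebra. For
  \<open>v\<close> outside it the equation may fail, which is why the spectral argument below stays
  inside this span.\<close>

lemma jpow_Suc_jprod_span:
  assumes "v \<in> span (range (jpow x))"
  shows "jpow x (Suc k) \<odot> v = x \<odot> (jpow x k \<odot> v)"
  using assms
proof (induction rule: span_induct_alt)
  case (step c u v)
  then obtain m where "u = jpow x m" by auto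
  moreover have "jpow x (Suc k) \<odot> jpow x m = x \<odot> (jpow x k \<odot> jpow x m)"
    by (simp only: jpow_add) simp
  ultimately show ?case
    using step by (simp add: jprod_linear_simps)
qed (simp add: jprod.zero_right)

lemma span_jpow_eigenvector:
  assumes v: "v \<in> span (range (jpow x))" "x \<odot> v = r *\<^sub>R v"
    and p: "p \<in> span (range (jpow x))"
  shows "\<exists>s. p \<odot> v = s *\<^sub>R v"
  using p
proof (induction rule: span_induct_alt)
  case base
  show ?case by (metis jprod.zero_left scaleR_zero_left)
next
  case (step c u y)
  then obtain m s where m: "u = jpow x m" and s: "y \<odot> v = s *\<^sub>R v" by auto
  have "jpow x m \<odot> v = r ^ m *\<^sub>R v"
  proof (induction m)
    case (Suc m)
    show ?case
      by (simp only: jpow_Suc_jprod_span[OF v(1)] Suc) (simp add: jprod_linear_simps v(2))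
  qed (simp add: junit_left)
  then have "(c *\<^sub>R u + y) \<odot> v = (c * r ^ m + s) *\<^sub>R v"
    by (simp add: m s jprod_linear_simps scaleR_add_left)
  then show ?case by blast
qed

lemma jprod_span_jpow:
  assumes "v \<in> span (range (jpow x))"
  shows "x \<odot> v \<in> span (range (jpow x))"
  using assms
proof (induction rule: span_induct_alt)
  case (step c u y)
  then obtain m where "u = jpow x m" by auto
  then have "x \<odot> u = jpow x (Suc m)" by simp
  then have "x \<odot> u \<in> span (range (jpow x))" by (simp only:) (rule span_base, simp only: rangeI)
  with step show ?case
    by (simp add: jprod_linear_simps span_add span_scale)
qed (simp add: jprod.zero_right span_zero)

text \<open>A nonnegative quadratic form is minimal where it vanishes, so its gradient
  \<open>2 *\<^sub>R B v\<close> must be zero there. Restricting to \<open>U\<close> lets this apply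
  to a Rayleigh maximizer in an invariant subspace.\<close>

lemma selfadjoint_psd_zero:
  fixes B :: "'a::euclidean_space \<Rightarrow> 'a"
  assumes "linear B" and U: "subspace U" and sym: "\<And>u v. inner (B u) v = inner u (B v)"
    and psd: "\<And>u. u \<in> U \<Longrightarrow> inner (B u) u \<ge> 0"
    and v: "v \<in> U" "B v \<in> U" "inner (B v) v = 0"
  shows "B v = 0"
proof -
  define u where "u = B v"
  define a where "a = inner u u"
  define b where "b = inner (B u) u"
  have "b \<ge> 0" using psd v by (simp add: b_def u_def)
  \<comment> \<open>A negative multiple of the gradient makes the form negative unless
    \<open>a = 0\<close>. The denominator \<open>b + 1\<close> instead of \<open>b\<close> covers
    the case \<open>b = 0\<close>.\<close>
  define s where "s = - a / (b + 1)"
  have s: "s * (b + 1) = - a" using \<open>b \<ge> 0\<close> by (simp add: s_def)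
  have "v + s *\<^sub>R u \<in> U"
    using U v by (simp add: u_def subspace_add subspace_scale)
  then have "0 \<le> inner (B (v + s *\<^sub>R u)) (v + s *\<^sub>R u)" by (rule psd)
  also have "\<dots> = 2 * s * a + s\<^sup>2 * b"
    using v(3) sym[of u v]
    by (simp add: linear_add[OF \<open>linear B\<close>] linear_scale[OF \<open>linear B\<close>] inner_add_left
        inner_add_right a_def b_def u_def[symmetric] power2_eq_square distrib_left)
  finally have "0 \<le> (b + 1)\<^sup>2 * (2 * s * a + s\<^sup>2 * b)" by simp
  also have "\<dots> = 2 * (b + 1) * (s * (b + 1)) * a + (s * (b + 1))\<^sup>2 * b"
    by (simp add: power2_eq_square algebra_simps)
  also have "\<dots> = - (a\<^sup>2 * (b + 2))"
    unfolding s by (simp add: power2_eq_square algebra_simps)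
  finally have "a\<^sup>2 * (b + 2) \<le> 0" by simp
  then have "a = 0" using \<open>b \<ge> 0\<close>
    by (smt (verit, best) zero_less_mult_iff zero_less_power2)
  then show ?thesis by (simp add: a_def u_def)
qed

text \<open>The form of \<open>B\<close> attains its maximum \<open>r\<close> on the unit sphere of
  \<open>U\<close>; then \<open>r - B\<close> is positive semidefinite on \<open>U\<close> and its
  form vanishes at the maximizer.\<close>

lemma selfadjoint_eigenvector_exists:
  fixes B :: "'a::euclidean_space \<Rightarrow> 'a"
  assumes B: "linear B" and U: "subspace U" and sym: "\<And>u v. inner (B u) v = inner u (B v)"
    and inv: "\<And>u. u \<in> U \<Longrightarrow> B u \<in> U" and ne: "U \<noteq> {0}"
  obtains v r where "v \<in> U" "v \<noteq> 0" "B v = r *\<^sub>R v"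
proof -
  define S where "S = sphere 0 1 \<inter> U"
  have "compact S"
    unfolding S_def by (intro compact_Int_closed compact_sphere closed_subspace U)
  moreover obtain u where u: "u \<in> U" "u \<noteq> 0"
    using ne subspace_0[OF U] by auto
  then have "u /\<^sub>R norm u \<in> S" by (simp add: S_def subspace_scale U)
  then have "S \<noteq> {}" by blast
  moreover have "continuous_on S (\<lambda>v. inner (B v) v)"
    using B by (intro continuous_on_inner linear_continuous_on continuous_on_id)
      (simp add: linear_conv_bounded_linear)
  ultimately obtain v where v: "v \<in> S" and max: "\<And>y. y \<in> S \<Longrightarrow> inner (B y) y \<le> inner (B v) v"
    using continuous_attains_sup[of S "\<lambda>v. inner (B v) v"] by blast
  define r where "r = inner (B v) v"
  define D where "D y = r *\<^sub>R y - B y" for y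
  have "D v = 0"
  proof (rule selfadjoint_psd_zero[where B = D, OF _ U])
    show "linear D"
      unfolding D_def by (auto intro!: linear_compose_sub B linear_compose_scale_right linear_ident)
    show "inner (D x) y = inner x (D y)" for x y
      by (simp add: D_def inner_diff_left inner_diff_right sym)
    show "inner (D y) y \<ge> 0" if "y \<in> U" for y
    proof (cases "y = 0")
      case False
      then have "y /\<^sub>R norm y \<in> S" using that by (simp add: S_def subspace_scale U)
      from max[OF this] have "inner (B y) y / (norm y)\<^sup>2 \<le> r"
        using False by (simp add: r_def linear_scale[OF B] power2_eq_square field_simps)
      then have "inner (B y) y \<le> r * (norm y)\<^sup>2" using False by (simp add: field_simps)
      then show ?thesis by (simp add: D_def inner_diff_left power2_norm_eq_inner)
    qed (simp add: D_def linear_0[OF B])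
    show "v \<in> U" using v by (simp add: S_def)
    then show "D v \<in> U" by (simp add: D_def inv subspace_diff subspace_scale U)
    show "inner (D v) v = 0"
      using v by (simp add: D_def inner_diff_left r_def S_def flip: power2_norm_eq_inner)
  qed
  then have "B v = r *\<^sub>R v" by (simp add: D_def)
  moreover have "v \<in> U" "v \<noteq> 0" using v by (auto simp: S_def)
  ultimately show thesis using that by blast
qed

text \<open>The part of \<open>A\<close> orthogonal to all eigenvectors in \<open>A\<close> is again
  invariant, so if it were nonzero it would contain another eigenvector.\<close>

lemma selfadjoint_span_eigenvectors:
  fixes B :: "'a::euclidean_space \<Rightarrow> 'a"
  assumes B: "linear B" and A: "subspace A" and sym: "\<And>u v. inner (B u) v = inner u (B v)"
    and inv: "\<And>u. u \<in> A \<Longrightarrow> B u \<in> A"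
  shows "A = span {v \<in> A. \<exists>r. B v = r *\<^sub>R v}"
proof -
  define W where "W = span {v \<in> A. \<exists>r. B v = r *\<^sub>R v}"
  have WA: "W \<subseteq> A" unfolding W_def by (rule span_minimal) (use A in auto)
  have BW: "B y \<in> W" if "y \<in> W" for y
    using that unfolding W_def
  proof (induction rule: span_induct_alt)
    case (step c x y)
    then show ?case
      by (auto simp: linear_add[OF B] linear_scale[OF B] inv subspace_scale[OF A]
          intro!: span_add[OF span_scale] intro: span_base)
  qed (simp add: linear_0[OF B] span_zero)
  define U where "U = A \<inter> orthogonal_comp W"
  have U: "subspace U" by (simp add: U_def A subspace_Int subspace_orthogonal_comp subspace_inter)
  have "B u \<in> U" if "u \<in> U" for u
    using that inv BW by (auto simp: U_def orthogonal_comp_def orthogonal_def sym[symmetric])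
  then have "U = {0}"
  proof (rule_tac ccontr)
    assume "U \<noteq> {0}" and "\<And>u. u \<in> U \<Longrightarrow> B u \<in> U"
    then obtain v r where v: "v \<in> U" "v \<noteq> 0" "B v = r *\<^sub>R v"
      using selfadjoint_eigenvector_exists[OF B U sym] by blast
    then have "v \<in> W" unfolding W_def by (auto simp: U_def intro: span_base)
    with v show False by (auto simp: U_def orthogonal_comp_def orthogonal_def)
  qed
  have "a \<in> W" if "a \<in> A" for a
  proof -
    obtain y z where yz: "y \<in> span W" "\<And>w. w \<in> span W \<Longrightarrow> orthogonal z w" "a = y + z"
      using orthogonal_subspace_decomp_exists[of W a] by blast
    have "span W = W" unfolding W_def by (rule span_span)
    with yz have "y \<in> W" by simp
    moreover have "z \<in> orthogonal_comp W"
      using yz(2) by (auto simp: orthogonal_comp_def orthogonal_commute span_base)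
    moreover have "z \<in> A"
      using yz(3) that \<open>y \<in> W\<close> WA A by (metis add_diff_cancel_left' subsetD subspace_diff)
    ultimately have "z \<in> U" by (simp add: U_def)
    then show ?thesis using \<open>U = {0}\<close> yz(3) \<open>y \<in> W\<close> by simp
  qed
  then have "A = W" using WA by blast
  then show ?thesis unfolding W_def .
qed

section \<open>Spectral decomposition\<close>

text \<open>A Jordan frame with primitivity weakened to being nonzero: the spectral idempotents of a
  single element have this form, and the functional and Peirce calculus can be carried out with
  it.\<close>

definition idempotent_system :: "'a::euclidean_jordan_algebra set \<Rightarrow> bool" where
  "idempotent_system C \<longleftrightarrow> finite C \<and> (\<forall>c\<in>C. idempotent c \<and> c \<noteq> 0) \<and>
     (\<forall>c\<in>C. \<forall>c'\<in>C. c \<noteq> c' \<longrightarrow> c \<odot> c' = 0) \<and> (\<Sum>c\<in>C. c) = \<e>"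

abbreviation combination :: "'a::euclidean_jordan_algebra set \<Rightarrow> ('a \<Rightarrow> real) \<Rightarrow> 'a" where
  "combination C l \<equiv> (\<Sum>c\<in>C. l c *\<^sub>R c)"

lemma idempotent_systemD:
  assumes "idempotent_system C"
  shows "finite C" "\<And>c. c \<in> C \<Longrightarrow> c \<odot> c = c" "\<And>c. c \<in> C \<Longrightarrow> c \<noteq> 0"
    "\<And>c d. c \<in> C \<Longrightarrow> d \<in> C \<Longrightarrow> c \<noteq> d \<Longrightarrow> c \<odot> d = 0" "(\<Sum>c\<in>C. c) = \<e>"
    "\<And>c d. c \<in> C \<Longrightarrow> d \<in> C \<Longrightarrow> c \<odot> d = (if c = d then c else 0)"
  using assms by (auto simp: idempotent_system_def idempotent_def)

lemma jordan_frame_idempotent_system: "jordan_frame C \<Longrightarrow> idempotent_system C"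
  by (auto simp: jordan_frame_def idempotent_system_def primitive_idempotent_def)

text \<open>Multiplication by \<open>c\<close> is a root of \<open>t (2 t - 1) (t - 1)\<close>: its
  possible eigenvalues are 0, 1/2 and 1.\<close>

lemma idempotent_cubic:
  assumes "c \<odot> c = c"
  shows "2 *\<^sub>R (c \<odot> (c \<odot> (c \<odot> v))) = 3 *\<^sub>R (c \<odot> (c \<odot> v)) - c \<odot> v"
proof -
  have three: "3 *\<^sub>R y = y + y + y" for y :: 'a
    using scaleR_add_left[of 2 1 y] by (simp add: scaleR_2)
  show ?thesis
    using jprod_assoc_expand[of c c c v] by (simp add: assms scaleR_2 three algebra_simps)
qed

lemma idempotent_inner_nonneg:
  assumes c: "c \<odot> c = c"
  shows "inner (c \<odot> v) v \<ge> 0"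
proof -
  define v1 v2 v3 where "v1 = c \<odot> v" and "v2 = c \<odot> v1" and "v3 = c \<odot> v2"
  define m2 m3 m4 where "m2 = inner v1 v1" and "m3 = inner v2 v1" and "m4 = inner v2 v2"
  have "2 *\<^sub>R v3 = 3 *\<^sub>R v2 - v1"
    using idempotent_cubic[OF c, of v] by (simp add: v1_def v2_def v3_def)
  then have cubic: "2 * inner v3 y = 3 * inner v2 y - inner v1 y" for y
    by (metis inner_diff_left inner_scaleR_left)
  have "inner v3 v = m3" "inner v2 v = m2" "inner v3 v1 = m4"
    by (simp_all add: v3_def v2_def v1_def m2_def m3_def m4_def inner_jprod)
  then have m: "inner v1 v = 3 * m2 - 2 * m3" "2 * m4 = 3 * m3 - m2"
    using cubic[of v] cubic[of v1] by (simp_all add: m2_def m3_def)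
  \<comment> \<open>The polynomial \<open>(2 t^2 - t)^2 + 8 (t - t^2)^2\<close> agrees with
    \<open>t\<close> at 0, 1/2 and 1. By the cubic relation, multiplication by \<open>c\<close> is
    therefore this sum of squares of self-adjoint operators.\<close>
  have "0 \<le> inner (2 *\<^sub>R v2 - v1) (2 *\<^sub>R v2 - v1) + 8 * inner (v1 - v2) (v1 - v2)"
    by simp
  also have "\<dots> = 12 * m4 - 20 * m3 + 9 * m2"
    by (simp add: inner_diff_left inner_diff_right inner_commute[of v1 v2] m2_def m3_def m4_def)
  also have "\<dots> = inner v1 v" using m by simp
  finally show ?thesis by (simp add: v1_def)
qed

lemma combination_jprod:
  assumes "idempotent_system C"
  shows "combination C l \<odot> combination C m = combination C (\<lambda>c. l c * m c)"
proof -
  have "combination C l \<odot> combination C m = (\<Sum>c\<in>C. \<Sum>d\<in>C. (l c * m d) *\<^sub>R (c \<odot> d))"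
    by (subst jprod.sum_left, subst jprod.sum_right) (simp add: jprod_linear_simps mult.commute)
  also have "\<dots> = (\<Sum>c\<in>C. \<Sum>d\<in>C. if d = c then (l c * m c) *\<^sub>R c else 0)"
    by (intro sum.cong refl) (auto simp: idempotent_systemD(6)[OF assms])
  finally show ?thesis
    by (simp add: sum.delta idempotent_systemD(1)[OF assms])
qed

lemma combination_jprod_member:
  assumes "idempotent_system C" "d \<in> C"
  shows "combination C l \<odot> d = l d *\<^sub>R d"
proof -
  have "combination C l \<odot> d = (\<Sum>c\<in>C. if c = d then l d *\<^sub>R d else 0)"
    unfolding jprod.sum_left jprod_linear_simps
    by (intro sum.cong refl) (auto simp: idempotent_systemD(6)[OF assms(1)] assms(2))
  then show ?thesis using assms by (simp add: idempotent_systemD(1))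
qed

lemma combination_one: "idempotent_system C \<Longrightarrow> combination C (\<lambda>_. 1) = \<e>"
  by (simp add: idempotent_systemD(5))

lemma inner_idempotents_nonneg:
  assumes "c \<odot> c = c" "d \<odot> d = d"
  shows "inner c d \<ge> 0"
  using idempotent_inner_nonneg[OF assms(1), of d] by (simp add: inner_jprod_left assms)

text \<open>Multiplication by \<open>c\<close> is positive semidefinite, and its form at
  \<open>d\<close> is \<open>inner c d\<close>.\<close>

lemma idempotents_orthogonal:
  assumes c: "c \<odot> c = c" and d: "d \<odot> d = d" and "inner c d = 0"
  shows "c \<odot> d = 0"
proof (rule selfadjoint_psd_zero[where U = UNIV and B = "\<lambda>v. c \<odot> v"])
  show "linear ((\<odot>) c)" by (simp add: linear_iff jprod_linear_simps)
  show "inner (c \<odot> d) d = 0" by (simp add: inner_jprod_left d assms(3))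
qed (auto intro: inner_jprod idempotent_inner_nonneg[OF c])

lemma idempotent_system_independent:
  assumes "idempotent_system C"
  shows "independent C"
proof (rule pairwise_orthogonal_independent)
  show "pairwise orthogonal C"
  proof (rule pairwiseI)
    fix c d assume "c \<in> C" "d \<in> C" "c \<noteq> d"
    then have "inner c d = inner (c \<odot> c) d" "c \<odot> d = 0" 
      using assms by (simp_all add: idempotent_systemD)
    then show "orthogonal c d" by (simp add: inner_jprod orthogonal_def)
  qed
  show "0 \<notin> C" using assms by (auto dest: idempotent_systemD(3))
qed

text \<open>On the algebra \<open>A\<close> generated by \<open>x\<close>, multiplication by
  \<open>x\<close> is self-adjoint, so \<open>A\<close> is spanned by eigenvectors. Each of them is
  an eigenvector of all of \<open>A\<close>, in particular of itself, and hence a multiple of an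
  idempotent.\<close>

lemma idempotent_system_exists:
  fixes x :: "'a::euclidean_jordan_algebra"
  obtains C l where "idempotent_system C" "x = combination C l"
proof -
  define A where "A = span (range (jpow x))"
  have e: "\<e> \<in> A" unfolding A_def by (rule span_base) (metis jpow.simps(1) rangeI)
  have "jpow x 1 \<in> A" unfolding A_def by (rule span_base) (rule rangeI)
  then have x: "x \<in> A" by (simp add: junit_right)
  define C where "C = {c \<in> A. c \<noteq> 0 \<and> idempotent c \<and> (\<exists>r. x \<odot> c = r *\<^sub>R c)}"
  have prod: "\<exists>s. p \<odot> v = s *\<^sub>R v" if "p \<in> A" "v \<in> A" "x \<odot> v = r *\<^sub>R v" for p v r
    using that span_jpow_eigenvector unfolding A_def by blast
  have eigen: "{v \<in> A. \<exists>r. x \<odot> v = r *\<^sub>R v} \<subseteq> span C"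
  proof safe
    fix v r assume v: "v \<in> A" "x \<odot> v = r *\<^sub>R v"
    show "v \<in> span C"
    proof (cases "v = 0")
      case False
      obtain s where s: "v \<odot> v = s *\<^sub>R v" using prod v by blast
      \<comment> \<open>Rules out nilpotent eigenvectors, so that \<open>v\<close> can be rescaled
        to an idempotent.\<close>
      have "inner (v \<odot> v) \<e> = inner v v" by (simp add: inner_jprod_left junit_right)
      then have "s \<noteq> 0" using False s by (metis inner_eq_zero_iff inner_zero_left scaleR_zero_left)
      define c where "c = v /\<^sub>R s"
      have "c \<in> C"
        using v False \<open>s \<noteq> 0\<close> s
        by (auto simp: C_def c_def A_def span_scale idempotent_def jprod_linear_simps)
      moreover have "v = s *\<^sub>R c" using \<open>s \<noteq> 0\<close> by (simp add: c_def)
      ultimately show ?thesis by (metis span_base span_scale)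
    qed (simp add: span_zero)
  qed
  have orth: "c \<odot> d = 0" if cd: "c \<in> C" "d \<in> C" "c \<noteq> d" for c d
  proof -
    \<comment> \<open>The product is a multiple of both factors. If it were nonzero, the factors
      would be proportional, and idempotence would make them equal.\<close>
    obtain s t where s: "c \<odot> d = s *\<^sub>R d" and t: "d \<odot> c = t *\<^sub>R c"
      using prod cd by (fastforce simp: C_def)
    have c: "c \<odot> c = c" and d: "d \<odot> d = d" using cd by (auto simp: C_def idempotent_def)
    show ?thesis
    proof (rule ccontr)
      assume "c \<odot> d \<noteq> 0"
      then have "s \<noteq> 0" using s by auto
      define u where "u = t / s"
      have "s *\<^sub>R d = t *\<^sub>R c" using s t by (simp add: jprod_commute)
      then have "inverse s *\<^sub>R s *\<^sub>R d = inverse s *\<^sub>R t *\<^sub>R c" by simp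
      then have u: "d = u *\<^sub>R c"
        using \<open>s \<noteq> 0\<close> by (simp add: u_def divide_inverse_commute)
      then have "(u * u) *\<^sub>R c = u *\<^sub>R c" using c d by (simp add: jprod_linear_simps)
      moreover have "c \<noteq> 0" "d \<noteq> 0" using cd by (auto simp: C_def)
      ultimately have "u = 1" using u by auto
      with u cd show False by simp
    qed
  qed
  have indep: "independent C"
  proof (rule pairwise_orthogonal_independent)
    show "pairwise orthogonal C"
    proof (rule pairwiseI)
      fix c d assume cd: "c \<in> C" "d \<in> C" "c \<noteq> d"
      then have "inner c d = inner (c \<odot> c) d" by (simp add: C_def idempotent_def)
      then show "orthogonal c d" by (simp add: inner_jprod orthogonal_def orth[OF cd])
    qed
  qed (simp add: C_def)
  then have fin: "finite C" by (rule independent_imp_finite)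
  have "A = span {v \<in> A. \<exists>r. x \<odot> v = r *\<^sub>R v}"
    by (rule selfadjoint_span_eigenvectors)
      (auto simp: linear_iff jprod_linear_simps inner_jprod A_def jprod_span_jpow)
  also have "\<dots> \<subseteq> span C" using eigen by (rule span_minimal) simp
  finally have AC: "A \<subseteq> span C" .
  obtain l where l: "x = combination C l" using x AC span_finite[OF fin] by fastforce
  obtain m where m: "\<e> = combination C m" using e AC span_finite[OF fin] by fastforce
  have idem: "c \<odot> c = c" if "c \<in> C" for c using that by (simp add: C_def idempotent_def)
  \<comment> \<open>The coefficients of the unit are found by multiplying it with a single member of
    \<open>C\<close>.\<close>
  have "m d = 1" if "d \<in> C" for d
  proof -
    have "d = combination C m \<odot> d" by (simp add: m[symmetric] junit_left)
    also have "\<dots> = (\<Sum>c\<in>C. if c = d then m d *\<^sub>R d else 0)"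
      unfolding jprod.sum_left jprod_linear_simps using that idem
      by (intro sum.cong refl) (auto simp: orth)
    also have "\<dots> = m d *\<^sub>R d" using that fin by simp
    finally have "(m d - 1) *\<^sub>R d = 0" by (simp add: scaleR_diff_left)
    moreover have "d \<noteq> 0" using that by (simp add: C_def)
    ultimately show ?thesis by simp
  qed
  then have "(\<Sum>c\<in>C. c) = \<e>" by (simp add: m)
  then have "idempotent_system C"
    unfolding idempotent_system_def
  proof (intro conjI ballI impI)
    fix c assume "c \<in> C"
    then show "idempotent c" "c \<noteq> 0" unfolding C_def by blast+
  qed (use fin orth in blast)+
  then show thesis using l that by blast
qed

lemma idempotent_sum_orthogonal:
  assumes a: "a \<odot> a = a" and b: "b \<odot> b = b" and "(a + b) \<odot> (a + b) = a + b"
  shows "a \<odot> b = 0"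
proof -
  have "2 *\<^sub>R (a \<odot> b) = (a + b) \<odot> (a + b) - a \<odot> a - b \<odot> b"
    by (simp add: jprod_linear_simps jprod_commute[of b a] scaleR_2)
  then show ?thesis using assms by simp
qed

text \<open>Splitting \<open>c\<close> keeps orthogonality to every other \<open>d\<close>:
  \<open>inner a d\<close> and \<open>inner b d\<close> are nonnegative with sum
  \<open>inner c d = 0\<close>, so both vanish.\<close>

lemma idempotent_system_refine:
  assumes C: "idempotent_system C" and c: "c \<in> C" "c = a + b" and ab: "idempotent a" "idempotent b"
    "a \<noteq> 0" "b \<noteq> 0"
  obtains D where "idempotent_system D" "card D = Suc (card C)" "span C \<subseteq> span D"
proof -
  note CD = idempotent_systemD[OF C]
  define D where "D = insert a (insert b (C - {c}))"
  have a: "a \<odot> a = a" and b: "b \<odot> b = b" using ab by (auto simp: idempotent_def)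
  have ab0: "a \<odot> b = 0" using idempotent_sum_orthogonal[OF a b] CD(2)[OF c(1)] c(2) by simp
  have other: "a \<odot> d = 0 \<and> b \<odot> d = 0" if "d \<in> C" "d \<noteq> c" for d
  proof -
    have d: "d \<odot> d = d" using CD that by blast
    have "c \<odot> d = 0" using CD(4) that c by metis
    then have "inner c d = 0" by (metis d inner_jprod_left inner_commute inner_zero_left)
    then have "inner a d + inner b d = 0" by (simp add: c(2) inner_add_left)
    then have "inner a d = 0" "inner b d = 0"
      using inner_idempotents_nonneg[OF a d] inner_idempotents_nonneg[OF b d] by auto
    then show ?thesis using idempotents_orthogonal a b d by blast
  qed
  have nin: "a \<notin> C - {c}" "b \<notin> C - {c}" "a \<noteq> b"
    using other a b ab0 ab(3,4) by force+
  have fin: "finite C" by (rule CD(1))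
  have sum: "(\<Sum>d\<in>D. d) = \<e>"
    using nin fin c CD(5) by (simp add: D_def sum.remove[of C c] add.assoc)
  have "idempotent_system D"
    unfolding idempotent_system_def
  proof (intro conjI ballI impI)
    show "c' \<odot> d = 0" if "c' \<in> D" "d \<in> D" "c' \<noteq> d" for c' d
    proof -
      have comm: "b \<odot> a = 0" "u \<in> C \<Longrightarrow> u \<noteq> c \<Longrightarrow> u \<odot> a = 0 \<and> u \<odot> b = 0" for u
        using other ab0 by (metis jprod_commute)+
      have "c' = a \<or> c' = b \<or> c' \<in> C \<and> c' \<noteq> c" "d = a \<or> d = b \<or> d \<in> C \<and> d \<noteq> c"
        using that by (auto simp: D_def)
      then show ?thesis
        using \<open>c' \<noteq> d\<close> by (elim disjE conjE) (simp_all add: comm other ab0 CD(4))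
    qed
  qed (use sum fin ab CD(2,3) in \<open>auto simp: D_def idempotent_def\<close>)
  moreover have "card D = Suc (card C)"
    using nin fin card.remove[OF fin c(1)] by (simp add: D_def)
  moreover have "c \<in> span D" unfolding c(2) by (intro span_add span_base) (auto simp: D_def)
  then have "C \<subseteq> span D" by (auto simp: D_def intro: span_base)
  then have "span C \<subseteq> span D" by (rule span_minimal) simp
  ultimately show thesis using that by blast
qed

text \<open>Among the systems whose span contains \<open>x\<close>, take one of maximal cardinality,
  which exists because members are linearly independent. A member that is not primitive could be
  split, contradicting maximality.\<close>

theorem spectral_decomposition_exists:
  fixes x :: "'a::euclidean_jordan_algebra"
  obtains C l where "spectral_decomposition x C l"
proof -
  define P where "P C \<longleftrightarrow> idempotent_system C \<and> x \<in> span C" for C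
  obtain C0 l0 where "idempotent_system C0" "x = combination C0 l0"
    by (rule idempotent_system_exists)
  then have "P C0" by (auto simp: P_def intro: span_sum span_scale span_base)
  moreover have "\<forall>C. P C \<longrightarrow> card C < Suc DIM('a)"
    using idempotent_system_independent independent_bound
    by (auto simp: P_def less_Suc_eq_le)
  ultimately have "\<exists>C. P C \<and> (\<forall>D. P D \<longrightarrow> card D \<le> card C)"
    by (rule Lattices_Big.ex_has_greatest_nat)
  then obtain C where C: "P C" and max: "\<And>D. P D \<Longrightarrow> card D \<le> card C"
    by blast
  have "primitive_idempotent c" if c: "c \<in> C" for c
    unfolding primitive_idempotent_def
  proof (intro conjI notI)
    assume "\<exists>a b. idempotent a \<and> idempotent b \<and> a \<noteq> 0 \<and> b \<noteq> 0 \<and> c = a + b"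
    then obtain a b where "idempotent a" "idempotent b" "a \<noteq> 0" "b \<noteq> 0" "c = a + b" by blast
    then obtain D where "idempotent_system D" "card D = Suc (card C)" "span C \<subseteq> span D"
      using idempotent_system_refine[of C c a b] C c by (auto simp: P_def)
    then show False using max[of D] C by (auto simp: P_def)
  qed (use C c in \<open>auto simp: P_def idempotent_system_def\<close>)
  then have "jordan_frame C"
    using C by (auto simp: P_def jordan_frame_def idempotent_system_def)
  moreover obtain l where "x = combination C l"
    using C span_finite[of C] by (fastforce simp: P_def idempotent_system_def)
  ultimately show thesis using that by (auto simp: spectral_decomposition_def)
qed

section \<open>Functional calculus and self-duality of the cone\<close>

lemma jpow_combination:
  assumes "idempotent_system C"
  shows "jpow (combination C l) k = combination C (\<lambda>c. l c ^ k)"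
  by (induction k) (simp_all add: idempotent_systemD(5)[OF assms] combination_jprod assms)

text \<open>A polynomial that interpolates \<open>f\<close> at all eigenvalues of both decompositions gives a
  formula for the two sides that does not mention the decomposition.\<close>

lemma combination_functional_unique:
  assumes C: "idempotent_system C" and D: "idempotent_system D" and eq: "combination C l = combination D m"
  shows "combination C (\<lambda>c. f (l c)) = combination D (\<lambda>c. f (m c))"
proof -
  define S where "S = l ` C \<union> m ` D"
  have fin: "finite S" using C D by (simp add: S_def idempotent_systemD(1))
  define p where "p = (\<Sum>s\<in>S. smult (f s / (\<Prod>t\<in>S - {s}. s - t)) (\<Prod>t\<in>S - {s}. [:- t, 1:]))"
  have p: "poly p r = f r" if "r \<in> S" for r
  proof -
    have "poly p r = (\<Sum>s\<in>S. f s / (\<Prod>t\<in>S - {s}. s - t) * (\<Prod>t\<in>S - {s}. r - t))"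
      by (simp add: p_def poly_sum poly_prod)
    also have "\<dots> = (\<Sum>s\<in>S. if s = r then f r else 0)"
    proof (intro sum.cong refl)
      fix s assume "s \<in> S"
      show "f s / (\<Prod>t\<in>S - {s}. s - t) * (\<Prod>t\<in>S - {s}. r - t) = (if s = r then f r else 0)"
      proof (cases "s = r")
        case False
        then have "(\<Prod>t\<in>S - {s}. r - t) = 0"
          using fin that by (intro prod_zero) auto
        then show ?thesis using False by simp
      next
        case True
        have "(\<Prod>t\<in>S - {r}. r - t) \<noteq> 0" using fin by (simp add: prod_zero_iff)
        then show ?thesis using True by simp
      qed
    qed
    finally show ?thesis using fin that by simp
  qed
  have "combination E (\<lambda>c. f (k c)) = (\<Sum>i\<le>degree p. coeff p i *\<^sub>R jpow (combination E k) i)"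
    if E: "idempotent_system E" and k: "k ` E \<subseteq> S" for E k
  proof -
    have "combination E (\<lambda>c. f (k c)) = combination E (\<lambda>c. poly p (k c))"
      using p k by (intro sum.cong) auto
    also have "\<dots> = (\<Sum>c\<in>E. \<Sum>i\<le>degree p. (coeff p i * k c ^ i) *\<^sub>R c)"
      by (simp add: poly_altdef scaleR_sum_left)
    also have "\<dots> = (\<Sum>i\<le>degree p. \<Sum>c\<in>E. (coeff p i * k c ^ i) *\<^sub>R c)"
      by (rule sum.swap)
    also have "\<dots> = (\<Sum>i\<le>degree p. coeff p i *\<^sub>R jpow (combination E k) i)"
      by (simp add: jpow_combination[OF E] scaleR_sum_right)
    finally show ?thesis .
  qed
  from this[OF C, of l] this[OF D, of m] show ?thesis by (simp add: S_def eq)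
qed

lemma spectral_map_eq:
  assumes sd: "spectral_decomposition u C l"
  shows "spectral_map f u = combination C (\<lambda>c. f (l c))"
  unfolding spectral_map_def
proof (rule the_equality)
  fix v assume "\<exists>C l. spectral_decomposition u C l \<and> v = combination C (\<lambda>c. f (l c))"
  then obtain D m where "spectral_decomposition u D m" "v = combination D (\<lambda>c. f (m c))" by blast
  then show "v = combination C (\<lambda>c. f (l c))"
    using sd combination_functional_unique[of D C m l f]
    by (auto simp: spectral_decomposition_def dest: jordan_frame_idempotent_system)
qed (use sd in blast)

section \<open>The cone of squares: self-duality, complementarity, interior\<close>

lemma square_in_cone: "u \<odot> u \<in> \<K>"
  by (auto simp: cone_of_squares_def)

lemma idempotent_in_cone: "c \<odot> c = c \<Longrightarrow> c \<in> \<K>"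
  by (metis square_in_cone)

lemma square_psd:
  shows "inner ((u \<odot> u) \<odot> v) v \<ge> 0"
proof -
  obtain C l where "spectral_decomposition u C l" by (rule spectral_decomposition_exists)
  then have C: "idempotent_system C" and u: "u = combination C l"
    by (auto simp: spectral_decomposition_def jordan_frame_idempotent_system)
  have "inner ((u \<odot> u) \<odot> v) v = (\<Sum>c\<in>C. (l c)\<^sup>2 * inner (c \<odot> v) v)"
    unfolding u combination_jprod[OF C]
    by (simp add: jprod.sum_left inner_sum_left jprod_linear_simps power2_eq_square)
  also have "\<dots> \<ge> 0"
    by (intro sum_nonneg mult_nonneg_nonneg idempotent_inner_nonneg idempotent_systemD(2)[OF C])
      simp_all
  finally show ?thesis .
qed

lemma cone_psd: "x \<in> \<K> \<Longrightarrow> inner (x \<odot> v) v \<ge> 0"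
  by (auto simp: cone_of_squares_def square_psd)

lemma inner_cone_nonneg:
  assumes "x \<in> \<K>" "y \<in> \<K>"
  shows "inner x y \<ge> 0"
proof -
  obtain u where "y = u \<odot> u" using assms by (auto simp: cone_of_squares_def)
  then have "inner x y = inner (x \<odot> u) u" by (simp add: inner_jprod_left)
  then show ?thesis using cone_psd assms by metis
qed

lemma combination_nonneg_in_cone:
  assumes "idempotent_system C" "\<And>c. c \<in> C \<Longrightarrow> l c \<ge> 0"
  shows "combination C l \<in> \<K>"
proof -
  have "combination C l = combination C (\<lambda>c. sqrt (l c) * sqrt (l c))"
    using assms(2) by (intro sum.cong) auto
  also have "\<dots> = combination C (\<lambda>c. sqrt (l c)) \<odot> combination C (\<lambda>c. sqrt (l c))"
    by (simp only: combination_jprod[OF assms(1)])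
  finally show ?thesis by (simp only: square_in_cone)
qed

lemma inner_combination_member:
  assumes "idempotent_system C" "d \<in> C"
  shows "inner (combination C l) d = l d * inner d d"
proof -
  have "inner (combination C l) d = inner (combination C l \<odot> d) d"
    using assms by (simp add: inner_jprod_left idempotent_systemD)
  then show ?thesis by (simp add: combination_jprod_member[OF assms])
qed

lemma combination_member_nonneg:
  assumes C: "idempotent_system C" "d \<in> C" and "inner (combination C l) d \<ge> 0"
  shows "l d \<ge> 0"
  using assms inner_combination_member[OF C, of l] idempotent_systemD(3)[OF C]
  by (simp add: zero_le_mult_iff) (metis inner_ge_zero inner_eq_zero_iff order_antisym_conv)

text \<open>Self-duality. For the converse, pairing \<open>x\<close> with the idempotents of its own
  frame, which lie in the cone, detects the signs of its eigenvalues; nonnegative eigenvalues have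
  square roots.\<close>

lemma cone_iff_inner: "x \<in> \<K> \<longleftrightarrow> (\<forall>y\<in>\<K>. inner x y \<ge> 0)"
proof
  assume *: "\<forall>y\<in>\<K>. inner x y \<ge> 0"
  obtain C l where "spectral_decomposition x C l" by (rule spectral_decomposition_exists)
  then have C: "idempotent_system C" and x: "x = combination C l"
    by (auto simp: spectral_decomposition_def jordan_frame_idempotent_system)
  show "x \<in> \<K>" unfolding x
  proof (rule combination_nonneg_in_cone[OF C])
    fix c assume "c \<in> C"
    then show "l c \<ge> 0"
      using combination_member_nonneg[OF C] * idempotent_in_cone idempotent_systemD(2)[OF C] x by metis
  qed
qed (simp add: inner_cone_nonneg)

lemma cone_innerI: "(\<And>y. y \<in> \<K> \<Longrightarrow> inner x y \<ge> 0) \<Longrightarrow> x \<in> \<K>"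
  using cone_iff_inner by blast

lemma cone_iff_psd: "x \<in> \<K> \<longleftrightarrow> (\<forall>v. inner (x \<odot> v) v \<ge> 0)"
proof
  assume *: "\<forall>v. inner (x \<odot> v) v \<ge> 0"
  have "inner x y \<ge> 0" if "y \<in> \<K>" for y
  proof -
    obtain u where "y = u \<odot> u" using \<open>y \<in> \<K>\<close> by (auto simp: cone_of_squares_def)
    then show ?thesis using *[rule_format, of u] by (simp only: inner_jprod_left)
  qed
  then show "x \<in> \<K>" by (rule cone_innerI)
qed (blast intro: cone_psd)

lemma cone_scaleR: "x \<in> \<K> \<Longrightarrow> r \<ge> 0 \<Longrightarrow> r *\<^sub>R x \<in> \<K>"
  by (rule cone_innerI) (simp add: inner_cone_nonneg)

lemma closed_cone: "closed (\<K> :: 'a::euclidean_jordan_algebra set)"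
proof -
  have "\<K> = (\<Inter>y\<in>\<K>. {x. 0 \<le> inner y (x :: 'a)})"
    by (auto simp: inner_cone_nonneg inner_commute intro: cone_innerI)
  moreover have "closed \<dots>"
    by (intro closed_INT ballI) (use closed_halfspace_ge in auto)
  ultimately show ?thesis by simp
qed

lemma cone_decomposition:
  assumes "x \<in> \<K>"
  obtains C l where "spectral_decomposition x C l" "idempotent_system C" "x = combination C l"
    "\<And>c. c \<in> C \<Longrightarrow> l c \<ge> 0"
proof -
  obtain C l where sd: "spectral_decomposition x C l" by (rule spectral_decomposition_exists)
  then have C: "idempotent_system C" and x: "x = combination C l"
    by (auto simp: spectral_decomposition_def jordan_frame_idempotent_system)
  have "l c \<ge> 0" if "c \<in> C" for c
    using combination_member_nonneg[OF C that] inner_cone_nonneg[OF assms] idempotent_in_cone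
      idempotent_systemD(2)[OF C that] x by metis
  with sd C x that show thesis by blast
qed

text \<open>Complementarity: over the frame of \<open>y\<close>, the pairing is a sum of nonnegative
  terms. Where the eigenvalue is nonzero, the positive semidefinite multiplication by
  \<open>x\<close> has a vanishing form at \<open>c\<close> and so kills \<open>c\<close>.\<close>

lemma cone_inner_zero_imp_jprod_zero:
  assumes x: "x \<in> \<K>" and y: "y \<in> \<K>" and 0: "inner x y = 0"
  shows "x \<odot> y = 0"
proof -
  obtain C l where C: "idempotent_system C" and yl: "y = combination C l"
    and l: "\<And>c. c \<in> C \<Longrightarrow> l c \<ge> 0"
    using cone_decomposition[OF y] by metis
  note CD = idempotent_systemD[OF C]
  have nonneg: "inner x c \<ge> 0" if "c \<in> C" for c
    by (rule inner_cone_nonneg[OF x idempotent_in_cone[OF CD(2)[OF that]]])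
  have "(\<Sum>c\<in>C. l c * inner x c) = 0" using 0 by (simp add: yl inner_sum_right)
  then have zero: "l c * inner x c = 0" if "c \<in> C" for c
    using that l nonneg CD(1) by (subst (asm) sum_nonneg_eq_0_iff) auto
  have "l c *\<^sub>R (x \<odot> c) = 0" if c: "c \<in> C" for c
  proof (cases "l c = 0")
    case False
    have "x \<odot> c = 0"
    proof (rule selfadjoint_psd_zero[where U = UNIV and B = "\<lambda>v. x \<odot> v"])
      show "linear ((\<odot>) x)" by (simp add: linear_iff jprod_linear_simps)
      show "inner (x \<odot> c) c = 0" using zero[OF c] False by (simp add: inner_jprod_left CD(2) c)
    qed (auto intro: inner_jprod cone_psd[OF x])
    then show ?thesis by simp
  qed simp
  then show ?thesis
    unfolding yl jprod.sum_right jprod_linear_simps by (intro sum.neutral ballI)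
qed

text \<open>Boundedness of the product makes multiplication by a small \<open>v\<close> at most the
  identity as a form, so \<open>cone_iff_psd\<close> applies.\<close>

lemma junit_minus_small_in_cone:
  obtains \<epsilon> :: real where "\<epsilon> > 0"
    "\<And>v :: 'a::euclidean_jordan_algebra. norm v \<le> \<epsilon> \<Longrightarrow> \<e> - v \<in> \<K>"
proof -
  obtain K :: real where K: "K > 0" "\<And>a b :: 'a. norm (a \<odot> b) \<le> norm a * norm b * K"
    using jprod.pos_bounded by blast
  have "\<e> - v \<in> \<K>" if v: "norm v \<le> 1 / K" for v :: 'a
    unfolding cone_iff_psd
  proof
    fix u :: 'a
    have "inner (v \<odot> u) u \<le> norm (v \<odot> u) * norm u" by (rule norm_cauchy_schwarz)
    also have "\<dots> \<le> (norm v * norm u * K) * norm u" by (intro mult_right_mono K) simp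
    also have "\<dots> = norm v * K * (norm u * norm u)" by simp
    also have "\<dots> \<le> 1 * (norm u * norm u)"
      using v K(1) by (intro mult_right_mono) (simp_all add: field_simps)
    finally show "inner ((\<e> - v) \<odot> u) u \<ge> 0"
      by (simp add: jprod_linear_simps junit_left inner_diff_left dot_square_norm power2_eq_square)
  qed
  then show thesis using that[of "1 / K"] K(1) by simp
qed

text \<open>Pair \<open>x\<close> with the cone element
  \<open>\<e> - (\<epsilon> / norm x) *\<^sub>R x\<close>. The bound makes the slice of the cone
  where \<open>inner \<e> z = 1\<close> compact.\<close>

lemma norm_le_inner_junit:
  obtains B :: real where "B > 0" "\<And>x :: 'a::euclidean_jordan_algebra. x \<in> \<K> \<Longrightarrow> norm x \<le> B * inner x \<e>"
proof -
  obtain \<epsilon> :: real where e: "\<epsilon> > 0" "\<And>v :: 'a. norm v \<le> \<epsilon> \<Longrightarrow> \<e> - v \<in> \<K>"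
    using junit_minus_small_in_cone by blast
  have "norm x \<le> (1 / \<epsilon>) * inner x \<e>" if x: "x \<in> \<K>" for x :: 'a
  proof (cases "x = 0")
    case False
    have "\<e> - (\<epsilon> / norm x) *\<^sub>R x \<in> \<K>" using e False by auto
    then have "0 \<le> inner x (\<e> - (\<epsilon> / norm x) *\<^sub>R x)" by (rule inner_cone_nonneg[OF x])
    also have "\<dots> = inner x \<e> - \<epsilon> * norm x"
      using False by (simp add: inner_diff_right dot_square_norm power2_eq_square)
    finally show ?thesis using e by (simp add: field_simps)
  qed simp
  then show thesis using that[of "1 / \<epsilon>"] e by simp
qed

text \<open>Subtracting a small multiple of a frame member \<open>c\<close> stays in the cone;
  pairing the result with \<open>c\<close> bounds the eigenvalue away from zero.\<close>

lemma interior_cone_decomposition: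
  assumes w: "w \<in> interior \<K>"
  obtains C l where "spectral_decomposition w C l" "idempotent_system C" "w = combination C l"
    "\<And>c. c \<in> C \<Longrightarrow> l c > 0"
proof -
  obtain C l where sd: "spectral_decomposition w C l" by (rule spectral_decomposition_exists)
  then have C: "idempotent_system C" and wl: "w = combination C l"
    by (auto simp: spectral_decomposition_def jordan_frame_idempotent_system)
  obtain r where r: "r > 0" "cball w r \<subseteq> \<K>" using w by (auto simp: mem_interior_cball)
  have "l c > 0" if c: "c \<in> C" for c
  proof -
    have n: "norm c > 0" using idempotent_systemD(3)[OF C c] by simp
    have "w - (r / norm c) *\<^sub>R c \<in> \<K>" using r n by (auto simp: dist_norm)
    moreover have "c \<in> \<K>" using idempotent_systemD(2)[OF C c] by (rule idempotent_in_cone)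
    ultimately have "0 \<le> inner (w - (r / norm c) *\<^sub>R c) c" by (rule inner_cone_nonneg)
    also have "\<dots> = (l c - r / norm c) * inner c c"
      by (simp add: inner_diff_left wl inner_combination_member[OF C c] left_diff_distrib)
    finally have "l c - r / norm c \<ge> 0"
      using n zero_le_mult_iff by (simp add: dot_square_norm zero_le_mult_iff)
    moreover have "r / norm c > 0" using r n by simp
    ultimately show ?thesis by linarith
  qed
  with sd C wl that show thesis by blast
qed

section \<open>Peirce decomposition and the quadratic representation\<close>

lemma linear_Q: "linear (Q u)"
  by (simp add: linear_iff Q_def jprod_linear_simps algebra_simps)

lemma Q_junit: "Q u \<e> = u \<odot> u"
  by (simp add: Q_def junit_right scaleR_2)

lemma Q_junit_left: "Q \<e> v = v"
  by (simp add: Q_def junit_left scaleR_2)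

lemma inner_Q: "inner (Q u v) z = inner v (Q u z)"
  by (simp add: Q_def inner_diff_left inner_diff_right inner_jprod)

text \<open>With a repeated idempotent and an orthogonal one, all mixed products in
  \<open>jordan_linearized\<close> vanish and the commutation remains.\<close>

lemma idempotent_system_commute:
  assumes C: "idempotent_system C" and cd: "c \<in> C" "d \<in> C"
  shows "c \<odot> (d \<odot> v) = d \<odot> (c \<odot> v)"
proof (cases "c = d")
  case False
  have "c \<odot> d = 0" "d \<odot> c = 0" "c \<odot> c = c"
    using idempotent_systemD(2,4)[OF C] cd False by auto
  then show ?thesis
    using jordan_linearized[of c c d v]
    by (simp add: jprod.zero_left jprod.zero_right)
qed simp

text \<open>On the image of multiplication by \<open>d\<close>, multiplication by \<open>c\<close>
  has only the eigenvalues 0 and 1/2; eigenvalue 1 is excluded by orthogonality.\<close>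

lemma idempotent_system_square_other:
  assumes C: "idempotent_system C" and cd: "c \<in> C" "d \<in> C" "c \<noteq> d"
  shows "2 *\<^sub>R (c \<odot> (c \<odot> (d \<odot> v))) = c \<odot> (d \<odot> v)"
proof -
  have "c \<odot> d = 0" "d \<odot> c = 0" "c \<odot> c = c"
    using idempotent_systemD(2,4)[OF C] cd by auto
  then show ?thesis
    using jprod_assoc_expand[of c c d v] idempotent_system_commute[OF C cd(1,2)]
    by (simp add: jprod.zero_left jprod.zero_right scaleR_2 algebra_simps)
qed

lemma idempotent_system_triple_zero:
  assumes C: "idempotent_system C" and "b \<in> C" "c \<in> C" "d \<in> C" and ne: "b \<noteq> c" "b \<noteq> d" "c \<noteq> d"
  shows "b \<odot> (c \<odot> (d \<odot> v)) = 0"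
proof -
  have "b \<odot> c = 0" "b \<odot> d = 0" "c \<odot> d = 0"
    using idempotent_systemD(4)[OF C] assms by auto
  then have "c \<odot> (b \<odot> (d \<odot> v)) + d \<odot> (b \<odot> (c \<odot> v)) = 0"
    using jprod_assoc_expand[of b c d v]
    by (simp add: jprod.zero_left jprod.zero_right algebra_simps)
  moreover have "c \<odot> (b \<odot> (d \<odot> v)) = b \<odot> (c \<odot> (d \<odot> v))"
    "d \<odot> (b \<odot> (c \<odot> v)) = b \<odot> (c \<odot> (d \<odot> v))"
    using idempotent_system_commute[OF C] assms by metis+
  ultimately have "2 *\<^sub>R (b \<odot> (c \<odot> (d \<odot> v))) = 0" by (simp add: scaleR_2)
  then show ?thesis by simp
qed

text \<open>For \<open>c = d\<close> this is the projection onto the Peirce space \<open>V\<^sub>c\<^sub>c\<close>; for \<open>c \<noteq> d\<close> it is half of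
  the projection onto \<open>V\<^sub>c\<^sub>d\<close>, since both \<open>(c, d)\<close> and \<open>(d, c)\<close> occur in double sums.\<close>

definition peirce :: "'a::euclidean_jordan_algebra \<Rightarrow> 'a \<Rightarrow> 'a \<Rightarrow> 'a" where
  "peirce c d v = 2 *\<^sub>R (c \<odot> (d \<odot> v)) - (if c = d then c \<odot> v else 0)"

text \<open>The Peirce spaces are joint eigenspaces of the system. The factor 2 clears the
  eigenvalue 1/2; for \<open>c = d\<close> both indicators count and give eigenvalue 1.\<close>

lemma jprod_peirce:
  assumes C: "idempotent_system C" and bcd: "b \<in> C" "c \<in> C" "d \<in> C"
  shows "2 *\<^sub>R (b \<odot> peirce c d v) = (of_bool (b = c) + of_bool (b = d)) *\<^sub>R peirce c d v"
proof (cases "c = d")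
  case eq: True
  show ?thesis
  proof (cases "b = c")
    case True
    have "2 *\<^sub>R (c \<odot> peirce c c v) = 2 *\<^sub>R (2 *\<^sub>R (c \<odot> (c \<odot> (c \<odot> v))) - c \<odot> (c \<odot> v))"
      by (simp add: peirce_def jprod_linear_simps scaleR_diff_right)
    also have "\<dots> = 2 *\<^sub>R peirce c c v"
      unfolding idempotent_cubic[OF idempotent_systemD(2)[OF C \<open>c \<in> C\<close>]]
      by (simp add: peirce_def algebra_simps flip: scaleR_diff_left)
    finally show ?thesis using True eq by simp
  next
    case False
    have "2 *\<^sub>R (c \<odot> (c \<odot> (b \<odot> v))) = c \<odot> (b \<odot> v)"
      using idempotent_system_square_other[OF C] bcd False by blast
    moreover have "b \<odot> (c \<odot> (c \<odot> v)) = c \<odot> (c \<odot> (b \<odot> v))" "b \<odot> (c \<odot> v) = c \<odot> (b \<odot> v)"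
      using idempotent_system_commute[OF C] bcd by metis+
    ultimately show ?thesis
      using False eq by (simp add: peirce_def jprod_linear_simps)
  qed
next
  case ne: False
  consider "b = c" | "b = d" | "b \<noteq> c" "b \<noteq> d" by blast
  then show ?thesis
  proof cases
    case 1
    then show ?thesis
      using idempotent_system_square_other[OF C bcd(2,3) ne] ne
      by (simp add: peirce_def jprod_linear_simps)
  next
    case 2
    have "2 *\<^sub>R (d \<odot> (d \<odot> (c \<odot> v))) = d \<odot> (c \<odot> v)"
      using idempotent_system_square_other[OF C bcd(3,2)] ne by blast
    moreover have "d \<odot> (c \<odot> v) = c \<odot> (d \<odot> v)"
      using idempotent_system_commute[OF C] bcd by metis
    ultimately show ?thesis
      using 2 ne by (simp add: peirce_def jprod_linear_simps)
  next
    case 3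
    then show ?thesis
      using idempotent_system_triple_zero[OF C bcd] ne
      by (simp add: peirce_def jprod_linear_simps)
  qed
qed

lemma combination_jprod_peirce:
  assumes C: "idempotent_system C" and cd: "c \<in> C" "d \<in> C"
  shows "combination C l \<odot> peirce c d v = ((l c + l d) / 2) *\<^sub>R peirce c d v"
proof -
  have fin: "finite C" by (rule idempotent_systemD(1)[OF C])
  have "2 *\<^sub>R (combination C l \<odot> peirce c d v) = (\<Sum>b\<in>C. l b *\<^sub>R 2 *\<^sub>R (b \<odot> peirce c d v))"
    by (simp add: jprod.sum_left jprod_linear_simps scaleR_sum_right mult.commute)
  also have "\<dots> = (\<Sum>b\<in>C. (l b * (of_bool (b = c) + of_bool (b = d))) *\<^sub>R peirce c d v)"
    by (intro sum.cong refl) (simp only: jprod_peirce[OF C _ cd] scaleR_scaleR)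
  also have "\<dots> = (\<Sum>b\<in>C. l b * (of_bool (b = c) + of_bool (b = d))) *\<^sub>R peirce c d v"
    by (simp only: scaleR_sum_left)
  also have "(\<Sum>b\<in>C. l b * (of_bool (b = c) + of_bool (b = d))) =
      (\<Sum>b\<in>C. if b = c then l c else 0) + (\<Sum>b\<in>C. if b = d then l d else 0)"
    unfolding sum.distrib[symmetric] by (intro sum.cong refl) auto
  also have "\<dots> = l c + l d"
    using fin cd by simp
  finally have "2 *\<^sub>R (combination C l \<odot> peirce c d v) = (l c + l d) *\<^sub>R peirce c d v" .
  then have "(1 / 2) *\<^sub>R 2 *\<^sub>R (combination C l \<odot> peirce c d v) = (1 / 2) *\<^sub>R (l c + l d) *\<^sub>R peirce c d v"
    by (simp only:)
  then show ?thesis by simp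
qed

lemma Q_combination_peirce:
  assumes C: "idempotent_system C" and cd: "c \<in> C" "d \<in> C"
  shows "Q (combination C l) (peirce c d v) = (l c * l d) *\<^sub>R peirce c d v"
proof -
  \<comment> \<open>The definition of \<open>Q\<close> on a Peirce space: twice the squared
    eigenvalue of \<open>u\<close>, minus the eigenvalue of \<open>u \<odot> u\<close>.\<close>
  have "2 * (((l c + l d) / 2) * ((l c + l d) / 2)) - (l c * l c + l d * l d) / 2 = l c * l d"
    by (simp add: field_simps)
  then show ?thesis
    by (simp add: Q_def combination_jprod[OF C] combination_jprod_peirce[OF C cd] jprod_linear_simps
        flip: scaleR_diff_left)
qed

lemma sum_peirce:
  assumes C: "idempotent_system C"
  shows "(\<Sum>c\<in>C. \<Sum>d\<in>C. peirce c d v) = v"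
proof -
  have fin: "finite C" by (rule idempotent_systemD(1)[OF C])
  have "(\<Sum>c\<in>C. \<Sum>d\<in>C. peirce c d v) =
      2 *\<^sub>R (\<Sum>c\<in>C. \<Sum>d\<in>C. c \<odot> (d \<odot> v)) - (\<Sum>c\<in>C. c \<odot> v)"
    using fin by (simp add: peirce_def sum_subtractf scaleR_sum_right)
  also have "\<dots> = 2 *\<^sub>R ((\<Sum>c\<in>C. c) \<odot> ((\<Sum>d\<in>C. d) \<odot> v)) - (\<Sum>c\<in>C. c) \<odot> v"
    by (simp only: jprod.sum_left jprod.sum_right[symmetric])
  finally show ?thesis
    by (simp add: idempotent_systemD(5)[OF C] junit_left scaleR_2)
qed

lemma Q_combination:
  assumes C: "idempotent_system C"
  shows "Q (combination C l) v = (\<Sum>c\<in>C. \<Sum>d\<in>C. (l c * l d) *\<^sub>R peirce c d v)"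
proof -
  have "Q (combination C l) v = Q (combination C l) (\<Sum>c\<in>C. \<Sum>d\<in>C. peirce c d v)"
    by (simp only: sum_peirce[OF C])
  also have "\<dots> = (\<Sum>c\<in>C. \<Sum>d\<in>C. Q (combination C l) (peirce c d v))"
    by (simp only: linear_sum[OF linear_Q])
  finally show ?thesis by (simp add: Q_combination_peirce[OF C])
qed

text \<open>Both operators are diagonal in the same Peirce decomposition, so eigenvalues multiply.
  This later makes \<open>Q (jsqrt w)\<close> and \<open>Q (jinvsqrt w)\<close> mutually
  inverse.\<close>

lemma Q_combination_mult:
  assumes C: "idempotent_system C"
  shows "Q (combination C l) (Q (combination C m) v) = Q (combination C (\<lambda>c. l c * m c)) v"
proof -
  have "Q (combination C l) (Q (combination C m) v) =
      (\<Sum>c\<in>C. \<Sum>d\<in>C. (m c * m d) *\<^sub>R Q (combination C l) (peirce c d v))"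
    by (simp only: Q_combination[OF C, of m] linear_sum[OF linear_Q] linear_scale[OF linear_Q])
  also have "\<dots> = (\<Sum>c\<in>C. \<Sum>d\<in>C. ((l c * m c) * (l d * m d)) *\<^sub>R peirce c d v)"
    by (simp add: Q_combination_peirce[OF C] algebra_simps)
  finally show ?thesis by (simp add: Q_combination[OF C])
qed

text \<open>For \<open>l c = exp (t * m c)\<close> the coefficients are half the
  \<open>t\<close>-derivatives of those of \<open>Q (combination C l) v\<close>; the next proof uses
  it in this form.\<close>

lemma combination_jprod_Q:
  assumes C: "idempotent_system C"
  shows "combination C m \<odot> Q (combination C l) v =
    (\<Sum>c\<in>C. \<Sum>d\<in>C. (l c * l d * ((m c + m d) / 2)) *\<^sub>R peirce c d v)"
  by (simp add: Q_combination[OF C] jprod.sum_right jprod_linear_simps combination_jprod_peirce[OF C])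

text \<open>If the claim failed, the function \<open>exp (- \<beta> t) \<langle>Q (exp (t x)) y, z\<rangle>\<close>, where
  \<open>exp x = combination C l\<close>, would have a negative minimum over \<open>t \<in> [0, 1]\<close> and
  \<open>z\<close> in a compact base of the cone. Minimality in \<open>z\<close> gives \<open>Q (exp (t x)) y \<odot> z = - r z\<close>
  with \<open>r > 0\<close>, so for large \<open>\<beta>\<close> the function is strictly increasing in \<open>t\<close> at the minimum.\<close>

lemma Q_combination_in_cone:
  fixes C :: "'a::euclidean_jordan_algebra set"
  assumes C: "idempotent_system C" and pos: "\<And>c. c \<in> C \<Longrightarrow> l c > 0" and y: "y \<in> \<K>"
  shows "Q (combination C l) y \<in> \<K>"
proof (rule cone_innerI, rule ccontr)
  fix z0 assume z0: "z0 \<in> \<K>" and "\<not> 0 \<le> inner (Q (combination C l) y) z0"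
  then have neg: "inner (Q (combination C l) y) z0 < 0" by simp
  define g where "g c = ln (l c)" for c
  define u where "u t = combination C (\<lambda>c. exp (t * g c))" for t :: real
  define x where "x = combination C g"
  define f where "f t z = inner (Q (u t) y) z" for t z
  have f: "f t z = (\<Sum>c\<in>C. \<Sum>d\<in>C. exp (t * (g c + g d)) * inner (peirce c d y) z)" for t z
    by (simp add: f_def u_def Q_combination[OF C] inner_sum_left distrib_left exp_add)
  have u0: "u 0 = \<e>" using idempotent_systemD(5)[OF C] by (simp add: u_def)
  have u1: "u 1 = combination C l" unfolding u_def g_def using pos by (intro sum.cong) auto
  obtain b where b: "b > 0" "\<And>z. z \<in> \<K> \<Longrightarrow> norm (z :: 'a) \<le> b * inner z \<e>"
    using norm_le_inner_junit by blast
  have pos_e: "inner z \<e> > 0" if "z \<in> \<K>" "z \<noteq> 0" for z :: 'a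
  proof -
    have "0 < b * inner z \<e>" using b(2)[of z] that by (smt (verit) zero_less_norm_iff)
    then show ?thesis using b(1) by (simp add: zero_less_mult_iff)
  qed
  define B where "B = \<K> \<inter> {z :: 'a. inner \<e> z = 1}"
  have B_norm: "norm z \<le> b" if "z \<in> B" for z
    using b(2)[of z] that by (simp add: B_def inner_commute)
  have "compact B"
    unfolding compact_eq_bounded_closed
  proof
    show "bounded B" using B_norm by (auto simp: bounded_iff)
    show "closed B" unfolding B_def by (intro closed_Int closed_cone closed_hyperplane)
  qed
  have scale: "z /\<^sub>R inner z \<e> \<in> B" if "z \<in> \<K>" "z \<noteq> 0" for z
    using pos_e[OF that] that by (simp add: B_def cone_scaleR inner_commute)
  \<comment> \<open>On \<open>B\<close> the term \<open>2 * inner x z\<close> is at most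
    \<open>2 * norm x * b\<close>, so \<open>\<beta>\<close> exceeds it by at least 1.\<close>
  define \<beta> where "\<beta> = 2 * norm x * b + 1"
  define h where "h p = exp (- \<beta> * fst p) * f (fst p) (snd p)" for p
  have "z0 \<noteq> 0" using neg by auto
  define z1 where "z1 = z0 /\<^sub>R inner z0 \<e>"
  have z1: "z1 \<in> B" unfolding z1_def by (rule scale[OF z0 \<open>z0 \<noteq> 0\<close>])
  have "f 1 z1 < 0"
    using neg pos_e[OF z0 \<open>z0 \<noteq> 0\<close>] by (simp add: f_def u1 z1_def mult_pos_neg)
  then have h1: "h (1, z1) < 0" by (simp add: h_def mult_pos_neg)
  have "compact ({0..1::real} \<times> B)" by (intro compact_Times compact_Icc \<open>compact B\<close>)
  moreover have "(1, z1) \<in> {0..1::real} \<times> B" using z1 by simp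
  then have "{0..1::real} \<times> B \<noteq> {}" by blast
  moreover have "continuous_on ({0..1} \<times> B) h"
    unfolding h_def f by (intro continuous_intros)
  ultimately obtain p where p: "p \<in> {0..1} \<times> B" and min: "\<And>q. q \<in> {0..1} \<times> B \<Longrightarrow> h p \<le> h q"
    using continuous_attains_inf[of "{0..1} \<times> B" h] by blast
  obtain t z where tz: "p = (t, z)" by (cases p)
  have t: "0 \<le> t" "t \<le> 1" and z: "z \<in> B" using p tz by auto
  have zK: "z \<in> \<K>" and ze: "inner \<e> z = 1" using z by (auto simp: B_def)
  define r where "r = - f t z"
  have "h (t, z) < 0" using min[of "(1, z1)"] z1 h1 tz by simp
  then have r: "r > 0" by (simp add: h_def r_def mult_less_0_iff)
  \<comment> \<open>At \<open>t = 0\<close> the operator is the identity, so a negative minimum lies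
    at positive \<open>t\<close>. It may lie at \<open>t = 1\<close>, and therefore only smaller
    times are compared with it below.\<close>
  have "f 0 z \<ge> 0" by (simp add: f_def u0 Q_junit_left inner_cone_nonneg y zK)
  with r have "t \<noteq> 0" by (auto simp: r_def)
  with t have "t > 0" by simp
  define v where "v = Q (u t) y"
  have v_min: "inner v z' \<ge> - r" if "z' \<in> B" for z'
    using min[of "(t, z')"] that t tz by (simp add: h_def v_def f_def r_def)
  \<comment> \<open>Minimality of \<open>z\<close> over the base, extended by scaling to the whole
    cone, is membership in the dual cone. Since the pairing with \<open>z\<close> vanishes,
    complementarity then yields the eigenvector equation for \<open>z\<close>.\<close>
  have "v + r *\<^sub>R \<e> \<in> \<K>"
  proof (rule cone_innerI)
    fix z' :: 'a assume z': "z' \<in> \<K>"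
    show "0 \<le> inner (v + r *\<^sub>R \<e>) z'"
    proof (cases "z' = 0")
      case False
      have "inner v (z' /\<^sub>R inner z' \<e>) \<ge> - r" using scale[OF z' False] by (rule v_min)
      then have "inner v z' \<ge> - r * inner z' \<e>"
        using pos_e[OF z' False] by (simp add: field_simps)
      then show ?thesis by (simp add: inner_add_left inner_commute[of z' \<e>])
    qed simp
  qed
  moreover have "inner (v + r *\<^sub>R \<e>) z = 0"
    by (simp add: inner_add_left inner_diff_left ze r_def v_def f_def)
  ultimately have "(v + r *\<^sub>R \<e>) \<odot> z = 0"
    using zK by (intro cone_inner_zero_imp_jprod_zero)
  then have vz: "v \<odot> z = - (r *\<^sub>R z)"
    by (simp add: jprod_linear_simps junit_left eq_neg_iff_add_eq_0)
  \<comment> \<open>This number is the \<open>t\<close>-derivative of \<open>f\<close> at the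
    minimum: the eigenvector equation evaluates it here, the Peirce expansion identifies it
    next.\<close>
  have "2 * inner (x \<odot> v) z = - 2 * r * inner x z"
    by (simp add: inner_jprod_left vz)
  moreover have "2 * inner (x \<odot> v) z =
      (\<Sum>c\<in>C. \<Sum>d\<in>C. (g c + g d) * exp (t * (g c + g d)) * inner (peirce c d y) z)"
    by (simp add: x_def v_def u_def combination_jprod_Q[OF C] inner_sum_left sum_distrib_left
        distrib_left exp_add mult.assoc mult.commute mult.left_commute)
  moreover have "((\<lambda>t. f t z) has_real_derivative
      (\<Sum>c\<in>C. \<Sum>d\<in>C. (g c + g d) * exp (t * (g c + g d)) * inner (peirce c d y) z)) (at t)"
    unfolding f by (auto intro!: derivative_eq_intros sum.cong simp: mult_ac)
  ultimately have f': "((\<lambda>t. f t z) has_real_derivative - 2 * r * inner x z) (at t)"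
    by simp
  have "((\<lambda>t. exp (- \<beta> * t) * f t z) has_real_derivative
      exp (- \<beta> * t) * (r * (\<beta> - 2 * inner x z))) (at t)"
    by (auto intro!: derivative_eq_intros f' simp: r_def algebra_simps)
  moreover have "exp (- \<beta> * t) * (r * (\<beta> - 2 * inner x z)) > 0"
  proof -
    have "inner x z \<le> norm x * norm z" by (rule norm_cauchy_schwarz)
    also have "\<dots> \<le> norm x * b" using B_norm[OF z] by (simp add: mult_left_mono)
    finally have "\<beta> - 2 * inner x z > 0" by (simp add: \<beta>_def)
    then show ?thesis using r by simp
  qed
  ultimately obtain \<delta> where \<delta>: "\<delta> > 0"
    "\<And>\<eta>. \<eta> > 0 \<Longrightarrow> \<eta> < \<delta> \<Longrightarrow> exp (- \<beta> * (t - \<eta>)) * f (t - \<eta>) z < exp (- \<beta> * t) * f t z"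
    using DERIV_pos_inc_left by blast
  define \<eta> where "\<eta> = min t (\<delta> / 2)"
  have "\<eta> > 0" "\<eta> < \<delta>" "\<eta> \<le> t" using \<delta>(1) \<open>t > 0\<close> by (auto simp: \<eta>_def)
  then have "h (t - \<eta>, z) < h (t, z)" using \<delta>(2) by (simp add: h_def)
  moreover have "h (t, z) \<le> h (t - \<eta>, z)"
    using min[of "(t - \<eta>, z)"] tz t z \<open>\<eta> \<le> t\<close> \<open>\<eta> > 0\<close> by simp
  ultimately show False by simp
qed

section \<open>Cone automorphisms that fix the unit\<close>

text \<open>The right side says that \<open>c\<close> is an extreme point of the order interval, in
  midpoint form. If \<open>c\<close> is idempotent, it pairs to zero with \<open>\<e> - c\<close>,
  and by complementarity any \<open>a\<close> as in the condition satisfies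
  \<open>a = a \<odot> c = c\<close>.\<close>

lemma idempotent_iff_extreme:
  "c \<odot> c = c \<longleftrightarrow> c \<in> \<K> \<and> \<e> - c \<in> \<K> \<and>
    (\<forall>a b. a \<in> \<K> \<and> \<e> - a \<in> \<K> \<and> b \<in> \<K> \<and> \<e> - b \<in> \<K> \<and> a + b = 2 *\<^sub>R c \<longrightarrow> a = c)"
proof
  assume c: "c \<odot> c = c"
  then have "(\<e> - c) \<odot> (\<e> - c) = \<e> - c"
    by (simp add: jprod_linear_simps junit_left junit_right)
  then have cK: "c \<in> \<K>" "\<e> - c \<in> \<K>" using c idempotent_in_cone by blast+
  have c0: "inner c (\<e> - c) = 0"
    using c inner_jprod_left[of c c \<e>] by (simp add: inner_diff_right junit_right)
  have "a = c" if a: "a \<in> \<K>" "\<e> - a \<in> \<K>" and b: "b \<in> \<K>" "\<e> - b \<in> \<K>" and ab: "a + b = 2 *\<^sub>R c"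
    for a b
  proof -
    have b_eq: "b = 2 *\<^sub>R c - a" using ab by (simp add: algebra_simps)
    have "inner a (\<e> - c) + inner b (\<e> - c) = 0"
      using c0 by (simp add: b_eq inner_diff_left)
    moreover have "inner a (\<e> - c) \<ge> 0" "inner b (\<e> - c) \<ge> 0"
      using a b cK inner_cone_nonneg by blast+
    ultimately have "inner a (\<e> - c) = 0" by linarith
    then have 1: "a \<odot> (\<e> - c) = 0" using a cK cone_inner_zero_imp_jprod_zero by blast
    have "inner (\<e> - a) c + inner (\<e> - b) c = 0"
      using c0 by (simp add: b_eq inner_diff_left inner_diff_right inner_commute)
    moreover have "inner (\<e> - a) c \<ge> 0" "inner (\<e> - b) c \<ge> 0"
      using a b cK inner_cone_nonneg by blast+
    ultimately have "inner (\<e> - a) c = 0" by linarith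
    then have 2: "(\<e> - a) \<odot> c = 0" using a cK cone_inner_zero_imp_jprod_zero by blast
    from 1 2 show "a = c" by (simp add: jprod_linear_simps junit_left junit_right)
  qed
  with cK show "c \<in> \<K> \<and> \<e> - c \<in> \<K> \<and>
    (\<forall>a b. a \<in> \<K> \<and> \<e> - a \<in> \<K> \<and> b \<in> \<K> \<and> \<e> - b \<in> \<K> \<and> a + b = 2 *\<^sub>R c \<longrightarrow> a = c)"
    by blast
next
  assume *: "c \<in> \<K> \<and> \<e> - c \<in> \<K> \<and>
    (\<forall>a b. a \<in> \<K> \<and> \<e> - a \<in> \<K> \<and> b \<in> \<K> \<and> \<e> - b \<in> \<K> \<and> a + b = 2 *\<^sub>R c \<longrightarrow> a = c)"
  obtain C l where C: "idempotent_system C" and cl: "c = combination C l"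
    and l0: "\<And>d. d \<in> C \<Longrightarrow> l d \<ge> 0"
    using cone_decomposition * by metis
  have diff: "\<e> - combination C m = combination C (\<lambda>d. 1 - m d)" for m
    by (simp add: scaleR_diff_left sum_subtractf idempotent_systemD(5)[OF C])
  have l1: "l d \<le> 1" if "d \<in> C" for d
  proof -
    have "inner (combination C (\<lambda>d. 1 - l d)) d \<ge> 0"
      using * that cl diff idempotent_systemD(2)[OF C that]
      by (metis idempotent_in_cone inner_cone_nonneg)
    then show ?thesis using combination_member_nonneg[OF C that] by fastforce
  qed
  have in_K: "combination C m \<in> \<K> \<and> \<e> - combination C m \<in> \<K>"
    if "\<And>d. d \<in> C \<Longrightarrow> 0 \<le> m d \<and> m d \<le> 1" for m
    unfolding diff using that by (auto intro!: combination_nonneg_in_cone[OF C])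
  \<comment> \<open>For \<open>0 \<le> t \<le> 1\<close> both \<open>t^2\<close> and
    \<open>2 t - t^2\<close> lie in the unit interval and have midpoint \<open>t\<close>. So
    \<open>c\<close> is the midpoint of \<open>c \<odot> c\<close> and another point of the order
    interval, and extremality gives \<open>c \<odot> c = c\<close>.\<close>
  define a where "a = combination C (\<lambda>d. l d * l d)"
  define b where "b = combination C (\<lambda>d. 2 * l d - l d * l d)"
  have "a \<in> \<K> \<and> \<e> - a \<in> \<K>"
    unfolding a_def using l0 l1 by (intro in_K) (auto intro: mult_le_one)
  moreover have "b \<in> \<K> \<and> \<e> - b \<in> \<K>"
    unfolding b_def
  proof (rule in_K)
    fix d assume d: "d \<in> C"
    have "0 \<le> l d * (2 - l d)" "0 \<le> (1 - l d) * (1 - l d)"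
      using l0[OF d] l1[OF d] by simp_all
    then show "0 \<le> 2 * l d - l d * l d \<and> 2 * l d - l d * l d \<le> 1"
      by (simp add: algebra_simps)
  qed
  moreover have "a + b = 2 *\<^sub>R c"
    by (simp add: a_def b_def cl scaleR_sum_right flip: sum.distrib scaleR_add_left)
  ultimately have "a = c" using * by blast
  then show "c \<odot> c = c" unfolding a_def cl by (simp add: combination_jprod[OF C])
qed

section \<open>Automorphisms of the cone and the structure preserved when they fix the unit\<close>

lemma cone_automorphism_iff: "cone_automorphism M \<Longrightarrow> M x \<in> \<K> \<longleftrightarrow> x \<in> \<K>"
  unfolding cone_automorphism_def by (metis bij_is_inj inj_image_mem_iff)

lemma cone_automorphism_inv:
  assumes "cone_automorphism M"
  shows "cone_automorphism (inv M)"
proof -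
  have M: "linear M" "bij M" "M ` \<K> = \<K>" using assms by (auto simp: cone_automorphism_def)
  have "linear (inv M)"
  proof (rule linearI)
    fix x y :: 'a and r :: real
    obtain x' y' where "x = M x'" "y = M y'" using M(2) by (metis bij_pointE)
    then show "inv M (x + y) = inv M x + inv M y" "inv M (r *\<^sub>R x) = r *\<^sub>R inv M x"
      using M(2) by (simp_all add: bij_is_inj flip: linear_add[OF M(1)] linear_scale[OF M(1)])
  qed
  moreover have "inv M ` \<K> = \<K>"
    using M by (metis bij_is_inj image_inv_f_f)
  ultimately show ?thesis using M by (simp add: cone_automorphism_def bij_imp_bij_inv)
qed

lemma cone_automorphism_compose:
  "cone_automorphism S \<Longrightarrow> cone_automorphism T \<Longrightarrow> cone_automorphism (S \<circ> T)"
  unfolding cone_automorphism_def by (metis bij_comp image_comp linear_compose)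

definition unital_automorphism :: "('a::euclidean_jordan_algebra \<Rightarrow> 'a) \<Rightarrow> bool" where
  "unital_automorphism M \<longleftrightarrow> cone_automorphism M \<and> M \<e> = \<e>"

lemma unital_automorphismD:
  assumes "unital_automorphism M"
  shows "linear M" "bij M" "M \<e> = \<e>" "cone_automorphism M" "inj M" "surj M"
    "\<And>x. inv M (M x) = x" "\<And>x. M (inv M x) = x"
proof -
  show M: "linear M" "bij M" "M \<e> = \<e>" "cone_automorphism M"
    using assms by (auto simp: unital_automorphism_def cone_automorphism_def)
  show "inj M" "surj M" using M(2) by (simp_all add: bij_is_inj bij_is_surj)
  then show "inv M (M x) = x" "M (inv M x) = x" for x by (simp_all add: surj_f_inv_f)
qed

lemma unital_automorphism_inv: "unital_automorphism M \<Longrightarrow> unital_automorphism (inv M)"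
  by (metis cone_automorphism_inv unital_automorphismD(4,7,3) unital_automorphism_def)

lemma unital_automorphism_idempotent:
  assumes M: "unital_automorphism M" and c: "idempotent c"
  shows "idempotent (M c)"
proof -
  note MD = unital_automorphismD[OF M]
  have K: "M x \<in> \<K> \<longleftrightarrow> x \<in> \<K>" for x by (rule cone_automorphism_iff[OF MD(4)])
  have e: "\<e> - M x = M (\<e> - x)" for x by (simp add: linear_diff[OF MD(1)] MD(3))
  have "M c \<odot> M c = M c"
    unfolding idempotent_iff_extreme
  proof (intro conjI allI impI)
    fix a b
    assume ab: "a \<in> \<K> \<and> \<e> - a \<in> \<K> \<and> b \<in> \<K> \<and> \<e> - b \<in> \<K> \<and> a + b = 2 *\<^sub>R M c"
    obtain a' b' where a': "a = M a'" and b': "b = M b'" using MD(8) by metis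
    have "M (a' + b') = M (2 *\<^sub>R c)"
      using ab by (simp add: a' b' linear_add[OF MD(1)] linear_scale[OF MD(1)])
    then have "a' + b' = 2 *\<^sub>R c" by (rule injD[OF MD(5)])
    moreover have "a' \<in> \<K>" "\<e> - a' \<in> \<K>" "b' \<in> \<K>" "\<e> - b' \<in> \<K>"
      using ab by (simp_all add: a' b' e K)
    ultimately have "a' = c" using c idempotent_iff_extreme[of c] by (auto simp: idempotent_def)
    then show "a = M c" by (simp add: a')
  qed (use c idempotent_iff_extreme[of c] in \<open>simp_all add: idempotent_def e K\<close>)
  then show ?thesis by (simp add: idempotent_def)
qed

lemma unital_automorphism_primitive:
  assumes M: "unital_automorphism M" and c: "primitive_idempotent c"
  shows "primitive_idempotent (M c)"
proof -
  note MD = unital_automorphismD[OF M] and ND = unital_automorphismD[OF unital_automorphism_inv[OF M]]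
  have nz: "M x \<noteq> 0" "inv M x \<noteq> 0" if "x \<noteq> 0" for x
    using that MD(7,8) linear_0[OF MD(1)] linear_0[OF ND(1)] by metis+
  have False
    if ab: "idempotent a" "idempotent b" "a \<noteq> 0" "b \<noteq> 0" "M c = a + b" for a b
  proof -
    have "c = inv M (M c)" by (simp add: MD(7))
    also have "\<dots> = inv M a + inv M b" by (simp add: ab(5) linear_add[OF ND(1)])
    finally have "c = inv M a + inv M b" .
    moreover have "idempotent (inv M a)" "idempotent (inv M b)"
      using ab unital_automorphism_idempotent[OF unital_automorphism_inv[OF M]] by blast+
    moreover have "inv M a \<noteq> 0" "inv M b \<noteq> 0" using ab nz by blast+
    ultimately show False using c unfolding primitive_idempotent_def by blast
  qed
  moreover have "idempotent (M c)" "M c \<noteq> 0"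
    using c nz unital_automorphism_idempotent[OF M] by (auto simp: primitive_idempotent_def)
  ultimately show ?thesis unfolding primitive_idempotent_def by blast
qed

text \<open>Products are not yet known to be preserved, but orthogonality of idempotents is
  equivalent to idempotence of their sum, which is.\<close>

lemma unital_automorphism_frame:
  assumes M: "unital_automorphism M" and C: "jordan_frame C"
  shows "jordan_frame (M ` C)"
proof -
  note MD = unital_automorphismD[OF M]
  note CD = idempotent_systemD[OF jordan_frame_idempotent_system[OF C]]
  have orth: "M c \<odot> M d = 0" if cd: "c \<in> C" "d \<in> C" "M c \<noteq> M d" for c d
  proof -
    have "c \<odot> c = c" "d \<odot> d = d" "c \<odot> d = 0" "d \<odot> c = 0"
      using cd CD by auto
    then have "idempotent c" "idempotent d" "idempotent (c + d)"
      by (simp_all add: idempotent_def jprod_linear_simps)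
    then have "idempotent (M c)" "idempotent (M d)" "idempotent (M c + M d)"
      using unital_automorphism_idempotent[OF M] by (metis linear_add[OF MD(1)])+
    then show ?thesis using idempotent_sum_orthogonal by (auto simp: idempotent_def)
  qed
  have "(\<Sum>c\<in>M ` C. c) = (\<Sum>c\<in>C. M c)"
    using MD(5) by (subst sum.reindex) (auto intro: inj_on_subset)
  also have "\<dots> = \<e>"
    using CD(5) MD(3) by (simp add: linear_sum[OF MD(1), symmetric])
  finally show ?thesis
    using C orth unital_automorphism_primitive[OF M] by (auto simp: jordan_frame_def)
qed

lemma unital_automorphism_spectral_decomposition:
  assumes M: "unital_automorphism M" and sd: "spectral_decomposition u C l"
  shows "spectral_decomposition (M u) (M ` C) (\<lambda>c. l (inv M c))"
proof -
  note MD = unital_automorphismD[OF M]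
  have "M u = (\<Sum>c\<in>C. l c *\<^sub>R M c)"
    using sd by (simp add: spectral_decomposition_def linear_sum[OF MD(1)] linear_scale[OF MD(1)])
  also have "\<dots> = combination (M ` C) (\<lambda>c. l (inv M c))"
    using MD(5) by (subst sum.reindex) (auto intro: inj_on_subset simp: MD(7))
  finally show ?thesis
    using sd unital_automorphism_frame[OF M] by (simp add: spectral_decomposition_def)
qed

lemma unital_automorphism_spectral_map:
  assumes M: "unital_automorphism M"
  shows "spectral_map f (M u) = M (spectral_map f u)"
proof -
  note MD = unital_automorphismD[OF M]
  obtain C l where sd: "spectral_decomposition u C l" by (rule spectral_decomposition_exists)
  have "spectral_map f (M u) = combination (M ` C) (\<lambda>c. f (l (inv M c)))"
    by (rule spectral_map_eq[OF unital_automorphism_spectral_decomposition[OF M sd]])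
  also have "\<dots> = (\<Sum>c\<in>C. f (l c) *\<^sub>R M c)"
    using MD(5) by (subst sum.reindex) (auto intro: inj_on_subset simp: MD(7))
  also have "\<dots> = M (spectral_map f u)"
    by (simp add: spectral_map_eq[OF sd] linear_sum[OF MD(1)] linear_scale[OF MD(1)])
  finally show ?thesis .
qed

lemma unital_automorphism_jtrace:
  assumes M: "unital_automorphism M"
  shows "jtrace (M u) = jtrace u"
proof -
  \<comment> \<open>The predicates that define the two traces are shown equivalent, with
    \<open>inv M\<close> for the reverse direction, so the definite descriptions coincide.\<close>
  have imp: "\<exists>C l. spectral_decomposition (N v) C l \<and> t = (\<Sum>c\<in>C. l c)"
    if N: "unital_automorphism N" and ex: "\<exists>C l. spectral_decomposition v C l \<and> t = (\<Sum>c\<in>C. l c)"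
    for N v t
  proof -
    note ND = unital_automorphismD[OF N]
    obtain C l where sd: "spectral_decomposition v C l" and t: "t = (\<Sum>c\<in>C. l c)" using ex by blast
    have "t = (\<Sum>c\<in>N ` C. l (inv N c))"
      using ND(5) unfolding t by (subst sum.reindex) (auto intro: inj_on_subset simp: ND(7))
    then show ?thesis using unital_automorphism_spectral_decomposition[OF N sd] by blast
  qed
  have "(\<exists>C l. spectral_decomposition (M u) C l \<and> t = (\<Sum>c\<in>C. l c)) \<longleftrightarrow>
      (\<exists>C l. spectral_decomposition u C l \<and> t = (\<Sum>c\<in>C. l c))" for t
    using imp[OF M, of u t] imp[OF unital_automorphism_inv[OF M], of "M u" t]
    by (auto simp: unital_automorphismD(7)[OF M])
  then show ?thesis by (simp add: jtrace_def)
qed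

lemma square_eq_spectral_map: "u \<odot> u = spectral_map (\<lambda>t. t * t) u"
proof -
  obtain C l where sd: "spectral_decomposition u C l" by (rule spectral_decomposition_exists)
  then show ?thesis
    unfolding spectral_map_eq[OF sd]
    by (auto simp: spectral_decomposition_def combination_jprod[OF jordan_frame_idempotent_system])
qed

text \<open>Squaring belongs to the functional calculus, which \<open>M\<close> respects;
  polarization then recovers the product.\<close>

lemma unital_automorphism_jprod:
  assumes M: "unital_automorphism M"
  shows "M (u \<odot> v) = M u \<odot> M v"
proof -
  note MD = unital_automorphismD[OF M]
  have square: "M (x \<odot> x) = M x \<odot> M x" for x
    by (simp only: square_eq_spectral_map unital_automorphism_spectral_map[OF M])
  have polar: "2 *\<^sub>R (x \<odot> y) = (x + y) \<odot> (x + y) - x \<odot> x - y \<odot> y" for x y :: 'a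
    by (simp add: jprod_linear_simps jprod_commute[of y x] scaleR_2)
  have "2 *\<^sub>R M (u \<odot> v) = 2 *\<^sub>R (M u \<odot> M v)"
    unfolding linear_scale[OF MD(1), symmetric] polar
    by (simp only: linear_diff[OF MD(1)] square linear_add[OF MD(1)])
  then show ?thesis by simp
qed

lemma unital_automorphism_inner:
  assumes trace_inner: "\<And>u v :: 'a::euclidean_jordan_algebra. inner u v = jtrace (u \<odot> v)"
    and M: "unital_automorphism (M :: 'a \<Rightarrow> 'a)"
  shows "inner (M u) (M v) = inner u v"
  by (simp only: trace_inner unital_automorphism_jprod[OF M, symmetric] unital_automorphism_jtrace[OF M])

lemma unital_automorphism_orthogonal:
  assumes trace_inner: "\<And>u v :: 'a::euclidean_jordan_algebra. inner u v = jtrace (u \<odot> v)"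
    and M: "unital_automorphism (M :: 'a \<Rightarrow> 'a)"
  shows "orthogonal_cone_automorphism M"
proof -
  note MD = unital_automorphismD[OF M]
  have "adjoint M = inv M"
  proof (rule adjoint_unique, intro allI)
    fix x y
    show "inner (M x) y = inner x (inv M y)"
      using unital_automorphism_inner[OF assms, of x "inv M y"] by (simp add: MD(8))
  qed
  then show ?thesis by (simp add: orthogonal_cone_automorphism_def MD(4))
qed

section \<open>Newton directions\<close>

lemma interior_cone_Q:
  fixes w :: "'a::euclidean_jordan_algebra"
  assumes w: "w \<in> interior \<K>"
  shows "Q (jsqrt w) (Q (jinvsqrt w) v) = v" "Q (jinvsqrt w) (Q (jsqrt w) v) = v"
    "Q (jsqrt w) \<e> = w" "Q (jinvsqrt w) w = \<e>" "Q (jsqrt w) (jinv w) = \<e>"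
    "cone_automorphism (Q (jsqrt w))" "cone_automorphism (Q (jinvsqrt w))"
proof -
  obtain C l where sd: "spectral_decomposition w C l" and C: "idempotent_system C"
    and wl: "w = combination C l" and pos: "\<And>c. c \<in> C \<Longrightarrow> l c > 0"
    using interior_cone_decomposition[OF w] by metis
  have sqrt: "jsqrt w = combination C (\<lambda>c. sqrt (l c))"
    and invsqrt: "jinvsqrt w = combination C (\<lambda>c. 1 / sqrt (l c))"
    and inv: "jinv w = combination C (\<lambda>c. inverse (l c))"
    by (simp_all add: jsqrt_def jinvsqrt_def jinv_def spectral_map_eq[OF sd])
  have cong: "combination C f = combination C g" if "\<And>c. c \<in> C \<Longrightarrow> f c = g c" for f g
    using that by (intro sum.cong) auto
  have one: "combination C (\<lambda>_. 1) = \<e>" by (rule combination_one[OF C])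
  have nz: "l c \<noteq> 0" if "c \<in> C" for c using pos[OF that] by simp
  have "combination C (\<lambda>c. sqrt (l c) * (1 / sqrt (l c))) = combination C (\<lambda>_. 1)"
    "combination C (\<lambda>c. 1 / sqrt (l c) * sqrt (l c)) = combination C (\<lambda>_. 1)"
    by (intro cong; simp add: nz)+
  then show cancel: "Q (jsqrt w) (Q (jinvsqrt w) v) = v" "Q (jinvsqrt w) (Q (jsqrt w) v) = v" for v
    by (simp_all only: sqrt invsqrt Q_combination_mult[OF C] one Q_junit_left)
  have "combination C (\<lambda>c. sqrt (l c) * sqrt (l c)) = combination C l"
    by (intro cong) (simp add: abs_of_pos pos)
  then show e: "Q (jsqrt w) \<e> = w"
    by (simp only: Q_junit sqrt combination_jprod[OF C] wl[symmetric])
  show "Q (jinvsqrt w) w = \<e>" using cancel(2)[of \<e>] by (simp only: e)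
  have "Q (jinvsqrt w) \<e> = jinv w"
    unfolding Q_junit invsqrt combination_jprod[OF C] inv
    by (intro cong) (simp add: field_simps abs_of_pos pos)
  then show "Q (jsqrt w) (jinv w) = \<e>" using cancel(1)[of \<e>] by simp
  have K: "Q (jsqrt w) y \<in> \<K>" "Q (jinvsqrt w) y \<in> \<K>" if "y \<in> \<K>" for y
    unfolding sqrt invsqrt using that pos by (auto intro!: Q_combination_in_cone[OF C])
  have bij: "bij (Q (jsqrt w))" "bij (Q (jinvsqrt w))"
    using cancel by (auto intro!: o_bij simp: fun_eq_iff)
  have "Q (jsqrt w) ` \<K> = \<K>" "Q (jinvsqrt w) ` \<K> = \<K>"
    using K cancel by (auto simp: image_iff) metis+
  with bij show "cone_automorphism (Q (jsqrt w))" "cone_automorphism (Q (jinvsqrt w))"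
    by (auto simp: cone_automorphism_def linear_Q)
qed

section \<open>Orthogonal projections\<close>

lemma proj_eqI:
  assumes N: "subspace N" and y: "y \<in> N" "x - y \<in> orthogonal_comp N"
  shows "proj N x = y"
  unfolding proj_def
proof (rule the_equality)
  fix z assume z: "z \<in> N \<and> x - z \<in> orthogonal_comp N"
  have "z - y \<in> N" using z y N subspace_diff by blast
  moreover have "(x - y) - (x - z) \<in> orthogonal_comp N"
    using z y(2) subspace_diff[OF subspace_orthogonal_comp] by blast
  then have "z - y \<in> orthogonal_comp N" by simp
  ultimately show "z = y" by (auto simp: orthogonal_comp_def orthogonal_def)
qed (use y in blast)

lemma proj_works:
  fixes N :: "'a::euclidean_space set"
  assumes N: "subspace N"
  shows "proj N x \<in> N" "x - proj N x \<in> orthogonal_comp N"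
proof -
  have "span N = N" using N by (simp add: span_eq_iff)
  then obtain y z where yz: "y \<in> N" "\<And>v. v \<in> N \<Longrightarrow> orthogonal z v" "x = y + z"
    using orthogonal_subspace_decomp_exists[of N x] by metis
  then have "x - y \<in> orthogonal_comp N" by (simp add: orthogonal_comp_def orthogonal_commute)
  with yz proj_eqI[OF N, of y x] show "proj N x \<in> N" "x - proj N x \<in> orthogonal_comp N" by simp_all
qed

lemma proj_orthogonal_comp:
  assumes N: "subspace N"
  shows "proj (orthogonal_comp N) x = x - proj N x"
proof (rule proj_eqI[OF subspace_orthogonal_comp])
  show "x - (x - proj N x) \<in> orthogonal_comp (orthogonal_comp N)"
    using proj_works(1)[OF N, of x] by (auto simp: orthogonal_comp_def orthogonal_commute)
qed (rule proj_works(2)[OF N])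

lemma proj_isometry:
  assumes N: "subspace N" and M: "linear M" "\<And>u v. inner (M u) (M v) = inner u v"
  shows "proj (M ` N) (M x) = M (proj N x)"
proof (rule proj_eqI)
  show "subspace (M ` N)" using M(1) N by (rule linear_subspace_image)
  show "M (proj N x) \<in> M ` N" using proj_works(1)[OF N] by blast
  show "M x - M (proj N x) \<in> orthogonal_comp (M ` N)"
    using proj_works(2)[OF N, of x]
    by (auto simp: orthogonal_comp_def orthogonal_def linear_diff[OF M(1), symmetric] M(2))
qed

text \<open>After scaling, the constraints say that \<open>d\<close> and \<open>p\<close> agree
  modulo \<open>N\<close>, and \<open>d\<close> and \<open>- q\<close> modulo the complement of
  \<open>N\<close>. So \<open>d\<close> takes its component orthogonal to \<open>N\<close> from
  \<open>p\<close> and its component in \<open>N\<close> from \<open>- q\<close>.\<close>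

lemma newton_direction_eq_summands:
  assumes w: "w \<in> interior \<K>" and L: "subspace L"
  shows "newton_direction x0 s0 L (orthogonal_comp L) w \<mu> =
    newton_summand1 x0 L w \<mu> - newton_summand2 s0 L w \<mu>"
proof -
  note W = interior_cone_Q[OF w]
  define A where "A = Q (jsqrt w)"
  define B where "B = Q (jinvsqrt w)"
  have lin: "linear A" "linear B" by (simp_all add: A_def B_def linear_Q)
  have AB: "A (B v) = v" "B (A v) = v" for v by (simp_all add: A_def B_def W)
  have e: "A \<e> = w" "B w = \<e>" "A (jinv w) = \<e>" by (simp_all add: A_def B_def W)
  define a where "a = (1 / sqrt \<mu>) *\<^sub>R x0"
  define b where "b = (1 / sqrt \<mu>) *\<^sub>R s0"
  define N where "N = B ` L"
  have N: "subspace N" unfolding N_def using lin(2) L by (rule linear_subspace_image)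
  define p where "p = B (a - w)"
  define q where "q = A (b - jinv w)"
  have summands: "newton_summand1 x0 L w \<mu> = p - proj N p" "newton_summand2 s0 L w \<mu> = proj N q"
    using proj_orthogonal_comp[OF N]
    by (simp_all add: newton_summand1_def newton_summand2_def p_def q_def a_def b_def N_def A_def B_def)
  have primal: "A (\<e> + d) \<in> {a + l | l. l \<in> L} \<longleftrightarrow> d - p \<in> N" for d
  proof -
    have "d - p = B (A (\<e> + d) - a)"
      by (simp add: p_def linear_diff[OF lin(2)] AB e)
    then have "d - p \<in> N \<longleftrightarrow> A (\<e> + d) - a \<in> L"
      unfolding N_def using AB(1) by (metis image_iff)
    also have "\<dots> \<longleftrightarrow> A (\<e> + d) \<in> {a + l | l. l \<in> L}"
      by (auto simp: algebra_simps) (metis diff_add_cancel)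
    finally show ?thesis by simp
  qed
  have dual: "B (\<e> - d) \<in> {b + l | l. l \<in> orthogonal_comp L} \<longleftrightarrow> d + q \<in> orthogonal_comp N" for d
  proof -
    have "B (d + q) = - (B (\<e> - d) - b)"
      using AB(2)[of "jinv w"]
      by (simp add: q_def linear_add[OF lin(2)] linear_diff[OF lin(2)] linear_diff[OF lin(1)] AB e)
    have "d + q \<in> orthogonal_comp N \<longleftrightarrow> B (d + q) \<in> orthogonal_comp L"
      by (auto simp: N_def orthogonal_comp_def orthogonal_def B_def inner_Q)
    also have "\<dots> \<longleftrightarrow> B (\<e> - d) - b \<in> orthogonal_comp L"
      using \<open>B (d + q) = _\<close> by (metis subspace_neg subspace_orthogonal_comp minus_minus)
    also have "\<dots> \<longleftrightarrow> B (\<e> - d) \<in> {b + l | l. l \<in> orthogonal_comp L}"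
      by (auto simp: algebra_simps) (metis diff_add_cancel)
    finally show ?thesis by simp
  qed
  have "newton_direction x0 s0 L (orthogonal_comp L) w \<mu> =
      (THE d. d - p \<in> N \<and> d + q \<in> orthogonal_comp N)"
    unfolding newton_direction_def a_def[symmetric] b_def[symmetric] A_def[symmetric] B_def[symmetric]
    by (simp only: primal dual)
  also have "\<dots> = p - proj N p - proj N q"
  proof (rule the_equality)
    have "- proj N p - proj N q \<in> N"
      using proj_works(1)[OF N] N by (simp add: subspace_diff subspace_neg)
    moreover have "(p - proj N p) + (q - proj N q) \<in> orthogonal_comp N"
      using proj_works(2)[OF N] subspace_orthogonal_comp by (blast intro: subspace_add)
    ultimately show "p - proj N p - proj N q - p \<in> N \<and> p - proj N p - proj N q + q \<in> orthogonal_comp N"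
      by (simp add: algebra_simps)
    fix d assume d: "d - p \<in> N \<and> d + q \<in> orthogonal_comp N"
    let ?d = "p - proj N p - proj N q"
    have "(d - p) - (?d - p) \<in> N"
      using d \<open>?d - p \<in> N \<and> _\<close> N by (blast intro: subspace_diff)
    moreover have "(d + q) - (?d + q) \<in> orthogonal_comp N"
      using d \<open>?d - p \<in> N \<and> _\<close> subspace_orthogonal_comp by (blast intro: subspace_diff)
    ultimately have "d - ?d \<in> N" "d - ?d \<in> orthogonal_comp N" by (simp_all add: algebra_simps)
    then have "d - ?d = 0" by (auto simp: orthogonal_comp_def orthogonal_def)
    then show "d = ?d" by simp
  qed
  finally show ?thesis by (simp add: summands)
qed

text \<open>The pairing of \<open>T x\<close> with \<open>adjoint (inv T) y\<close> equals that of
  \<open>x\<close> with \<open>y\<close>. This brings the transformed dual constraint into the form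
  that \<open>newton_direction_eq_summands\<close> requires.\<close>

lemma orthogonal_comp_image:
  fixes T :: "'a::euclidean_space \<Rightarrow> 'a"
  assumes T: "linear T" "bij T" "linear (inv T)"
  shows "adjoint (inv T) ` orthogonal_comp L = orthogonal_comp (T ` L)"
proof -
  have T_inv: "T (inv T x) = x" "inv T (T x) = x" for x
    using T(2) by (simp_all add: bij_is_surj bij_is_inj surj_f_inv_f)
  have adj: "inner x (adjoint T y) = inner (T x) y" "inner x (adjoint (inv T) y) = inner (inv T x) y" for x y
    by (simp_all add: adjoint_works T)
  have "y = adjoint (inv T) (adjoint T y)" for y
    by (rule vector_eq_rdot[THEN iffD1]) (metis adj T_inv inner_commute)
  moreover have "adjoint T y \<in> orthogonal_comp L \<longleftrightarrow> y \<in> orthogonal_comp (T ` L)" for y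
    by (auto simp: orthogonal_comp_def orthogonal_def adj)
  moreover have "adjoint (inv T) y \<in> orthogonal_comp (T ` L)" if "y \<in> orthogonal_comp L" for y
    using that by (auto simp: orthogonal_comp_def orthogonal_def adj T_inv)
  ultimately show ?thesis by blast
qed

theorem proposition2p5:
  fixes n :: nat
    and L :: "'a::euclidean_jordan_algebra set"
    and x0 s0 w :: 'a
    and \<mu> :: real
    and \<alpha> :: "'a \<Rightarrow> 'a \<Rightarrow> real"
    and T :: "'a \<Rightarrow> 'a"
  assumes rank: "jordan_rank TYPE('a) = n"
    and trace_inner: "\<And>u v :: 'a. inner u v = jtrace (u \<odot> v)"
    and L: "subspace L"
    and slater_primal: "interior \<K> \<inter> {x0 + l | l. l \<in> L} \<noteq> {}"
    and slater_dual: "interior \<K> \<inter> {s0 + l | l. l \<in> orthogonal_comp L} \<noteq> {}"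
    and \<alpha>_invariant: "\<And>M. orthogonal_cone_automorphism M \<Longrightarrow>
                        (\<forall>d1 d2. \<alpha> d1 d2 = \<alpha> (M d1) (M d2))"
    and T: "cone_automorphism T"
    and w: "w \<in> interior \<K>"
    and \<mu>: "\<mu> > 0"
  shows "let d = newton_direction x0 s0 L (orthogonal_comp L) w \<mu>;
             d1 = newton_summand1 x0 L w \<mu>;
             d2 = newton_summand2 s0 L w \<mu>;
             T' = adjoint (inv T);
             w_t = T w;
             d_t = newton_direction (T x0) (T' s0) (T ` L) (T' ` orthogonal_comp L) w_t \<mu>;
             d1_t = newton_summand1 (T x0) (T ` L) w_t \<mu>;
             d2_t = newton_summand2 (T' s0) (T ` L) w_t \<mu>
         in Q (jsqrt w_t) (jexp (\<alpha> d1_t d2_t *\<^sub>R d_t)) =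
            T (Q (jsqrt w) (jexp (\<alpha> d1 d2 *\<^sub>R d)))"
proof -
  have lT: "linear T" and bT: "bij T" and KT: "T ` \<K> = \<K>"
    using T by (auto simp: cone_automorphism_def)
  have liT: "linear (inv T)" using cone_automorphism_inv[OF T] by (simp add: cone_automorphism_def)
  have T_inv: "inv T (T x) = x" for x using bT by (simp add: bij_is_inj)
  define T' where "T' = adjoint (inv T)"
  have lT': "linear T'" unfolding T'_def using liT by (rule adjoint_linear)
  have adj: "inner (T' y) x = inner y (inv T x)" for x y
    by (simp add: T'_def inner_commute adjoint_works[OF liT] flip: adjoint_clauses)
  have wt: "T w \<in> interior \<K>"
    using w KT interior_injective_linear_image[OF lT bij_is_inj[OF bT], of \<K>] by auto
  note W = interior_cone_Q[OF w] and Wt = interior_cone_Q[OF wt]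
  define A where "A = Q (jsqrt w)"
  define B where "B = Q (jinvsqrt w)"
  define At where "At = Q (jsqrt (T w))"
  define Bt where "Bt = Q (jinvsqrt (T w))"
  have lin: "linear A" "linear B" "linear At" "linear Bt"
    by (simp_all add: A_def B_def At_def Bt_def linear_Q)
  define M where "M = Bt \<circ> T \<circ> A"
  have M: "unital_automorphism M"
    unfolding unital_automorphism_def
    by (simp add: M_def A_def Bt_def W Wt T cone_automorphism_compose)
  note MD = unital_automorphismD[OF M]
  have M_inner: "inner (M u) (M v) = inner u v" for u v
    by (rule unital_automorphism_inner[OF trace_inner M])
  have At_M: "At (M v) = T (A v)" for v by (simp add: M_def At_def Bt_def Wt)
  have Bt_T: "Bt (T v) = M (B v)" for v by (simp add: M_def A_def B_def W)
  \<comment> \<open>The dual counterpart of \<open>Bt_T\<close>: since \<open>M\<close> is an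
    isometry it equals its inverse adjoint, which is \<open>At \<circ> T' \<circ> B\<close>.\<close>
  have At_T': "At (T' y) = M (A y)" for y
  proof (rule vector_eq_rdot[THEN iffD1], rule allI)
    fix z
    obtain z' where z': "z = M z'" using MD(8) by metis
    have "inner (At (T' y)) z = inner (T' y) (At z)" by (simp add: At_def inner_Q)
    also have "\<dots> = inner y (A z')" by (simp add: z' At_M adj T_inv)
    also have "\<dots> = inner (M (A y)) z" by (simp add: z' M_inner A_def inner_Q)
    finally show "inner (At (T' y)) z = inner (M (A y)) z" .
  qed
  define N where "N = B ` L"
  have N: "subspace N" unfolding N_def using lin(2) L by (rule linear_subspace_image)
  have Nt: "Bt ` T ` L = M ` N" by (simp add: N_def image_image Bt_T)
  have Ls: "subspace (T ` L)" using lT L by (rule linear_subspace_image)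
  have N': "subspace (M ` N)" using MD(1) N by (rule linear_subspace_image)
  define r where "r = 1 / sqrt \<mu>"
  define d1 where "d1 = newton_summand1 x0 L w \<mu>"
  define d2 where "d2 = newton_summand2 s0 L w \<mu>"
  have d1: "newton_summand1 (T x0) (T ` L) (T w) \<mu> = M d1"
  proof -
    have "Bt (r *\<^sub>R T x0 - T w) = M (B (r *\<^sub>R x0 - w))"
      by (simp add: linear_diff[OF lT] linear_scale[OF lT] flip: Bt_T)
    then show ?thesis
      unfolding d1_def newton_summand1_def r_def[symmetric] Bt_def[symmetric] B_def[symmetric]
        Nt N_def[symmetric]
      by (simp add: proj_orthogonal_comp[OF N] proj_orthogonal_comp[OF N'] linear_diff[OF MD(1)]
          proj_isometry[OF N MD(1) M_inner])
  qed
  have d2: "newton_summand2 (T' s0) (T ` L) (T w) \<mu> = M d2"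
  proof -
    \<comment> \<open>Scaling turns both inverses into \<open>\<e>\<close>, which \<open>M\<close>
      fixes.\<close>
    have "At (jinv (T w)) = M (A (jinv w))"
      by (simp add: At_def A_def W Wt MD(3))
    then have "At (r *\<^sub>R T' s0 - jinv (T w)) = M (A (r *\<^sub>R s0 - jinv w))"
      by (simp add: linear_diff[OF lin(1)] linear_diff[OF lin(3)] linear_scale[OF lin(1)]
          linear_scale[OF lin(3)] linear_diff[OF MD(1)] linear_scale[OF MD(1)] At_T')
    then show ?thesis
      unfolding d2_def newton_summand2_def r_def[symmetric] Bt_def[symmetric] B_def[symmetric]
        At_def[symmetric] A_def[symmetric] Nt N_def[symmetric]
      by (simp add: proj_isometry[OF N MD(1) M_inner])
  qed
  have d: "newton_direction x0 s0 L (orthogonal_comp L) w \<mu> = d1 - d2"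
    by (simp add: newton_direction_eq_summands[OF w L] d1_def d2_def)
  have dt: "newton_direction (T x0) (T' s0) (T ` L) (T' ` orthogonal_comp L) (T w) \<mu> = M (d1 - d2)"
    unfolding T'_def orthogonal_comp_image[OF lT bT liT] newton_direction_eq_summands[OF wt Ls]
    by (simp add: d1 d2 linear_diff[OF MD(1)] flip: T'_def)
  have \<alpha>: "\<alpha> (M d1) (M d2) = \<alpha> d1 d2"
    using \<alpha>_invariant[OF unital_automorphism_orthogonal[OF trace_inner M]] by simp
  have "At (jexp (\<alpha> d1 d2 *\<^sub>R M (d1 - d2))) = T (A (jexp (\<alpha> d1 d2 *\<^sub>R (d1 - d2))))"
    by (simp add: jexp_def unital_automorphism_spectral_map[OF M] At_M
        flip: linear_scale[OF MD(1)])
  then show ?thesis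
    unfolding Let_def T'_def[symmetric] d dt d1 d2 d1_def[symmetric] d2_def[symmetric] \<alpha>
      At_def A_def .
qed

end
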